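(* Let $X$ be a compact metric space, $f:X\to X$ a continuous map and $\mu$ a Borel probability measure on $X$ (not necessarily $f$-invariant) such that $(f,X,\mu)$ is empirical. Let $\mu_o$ and $\mu_1$ be Borel probability measures on $X$ such that $\mu=t\,\mu_o+(1-t)\,\mu_1$ with $t\in(0,1)$. Then for any $\mathrm{Scl}\in\{\mathrm{Dim},\mathrm{Ord}\}$, $$\overline{\mathrm{Scl}}\,\mathscr E^{loc}_\mu(f)=t\,\overline{\mathrm{Scl}}\,\mathscr E^{loc}_{\mu_o}(f)+(1-t)\,\overline{\mathrm{Scl}}\,\mathscr E^{loc}_{\mu_1}(f),$$ $$\underline{\mathrm{Scl}}\,\mathscr E^{loc}_\mu(f)=t\,\underline{\mathrm{Scl}}\,\mathscr E^{loc}_{\mu_o}(f)+(1-t)\,\underline{\mathrm{Scl}}\,\mathscr E^{loc}_{\mu_1}(f).$$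
   Context: $\mathcal M(X)$ is the space of Borel probability measures on $X$ with the Kantorovich–Wasserstein distance $\mathsf d(\mu_1,\mu_2)=\sup_{\phi\ 1\text{-Lipschitz}}\int\phi\,d(\mu_1-\mu_2)$. With $\mathsf e^f_n(x)=\frac1n\sum_{0\le k<n}\delta_{f^k(x)}$, the system $(f,X,\mu)$ is empirical if $\mathsf e^f(x)=\lim_n\mathsf e^f_n(x)$ exists in $\mathcal M(X)$ for $\mu$-a.e. $x$; then $\mathsf e^f_*\mu\in\mathcal M(\mathcal M(X))$ is the pushforward. For a function $\varphi$ of $\epsilon>0$ with values in $[0,\infty)$, $\overline{\mathrm{Dim}}\,\varphi$ and $\underline{\mathrm{Dim}}\,\varphi$ are the $\limsup$ and $\liminf$ as $\epsilon\to0$ of $\frac{|\log\varphi(\epsilon)|}{|\log\epsilon|}$, and $\overline{\mathrm{Ord}}\,\varphi$, $\underline{\mathrm{Ord}}\,\varphi$ are the $\limsup$ and $\liminf$ of $\frac{\log|\log\varphi(\epsilon)|}{|\log\epsilon|}$ (conventions: both orders are $0$ if $\varphi(\epsilon)=1$ for all small $\epsilon$; $|\log 0|=\log(+\infty)=+\infty$). For a probability measure $\nu$ on a metric space $Y$ and $y\in Y$, $\overline{\mathrm{Scl}}_{loc}\nu(y)=\overline{\mathrm{Scl}}(\epsilon\mapsto\nu(B(y,\epsilon)))$ and $\underline{\mathrm{Scl}}_{loc}\nu(y)=\underline{\mathrm{Scl}}(\epsilon\mapsto\nu(B(y,\epsilon)))$. The local emergences are $\overline{\mathrm{Scl}}\,\mathscr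 E^{loc}_\mu(f)=\int\overline{\mathrm{Scl}}_{loc}(\mathsf e^f_*\mu)\,d(\mathsf e^f_*\mu)$ and $\underline{\mathrm{Scl}}\,\mathscr E^{loc}_\mu(f)=\int\underline{\mathrm{Scl}}_{loc}(\mathsf e^f_*\mu)\,d(\mathsf e^f_*\mu)$, with values in $[0,\infty]$. Since $\mu_o,\mu_1$ are absolutely continuous with respect to $\mu$, $(f,X,\mu_o)$ and $(f,X,\mu_1)$ are also empirical. *)

theory Defs
  imports "HOL-Probability.Probability"
begin

definition prob_measures :: "'a::topological_space measure set" where
  "prob_measures = {\<nu>. sets \<nu> = sets borel \<and> prob_space \<nu>}"

text \<open>The supremum is finite when the space is compact, all integrands being then integrable.
  The value 0 outside \<^const>\<open>prob_measures\<close> is only there because the locale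
  \<^locale>\<open>Metric_space\<close> asks for a distance function that is nonnegative and
  symmetric on the whole type.\<close>

definition kant_dist :: "'a::metric_space measure \<Rightarrow> 'a measure \<Rightarrow> real" where
  "kant_dist \<mu>\<^sub>1 \<mu>\<^sub>2 =
    (if \<mu>\<^sub>1 \<in> prob_measures \<and> \<mu>\<^sub>2 \<in> prob_measures
     then (SUP \<phi> \<in> {\<phi> :: 'a \<Rightarrow> real. 1-lipschitz_on UNIV \<phi>}.
             (LINT x|\<mu>\<^sub>1. \<phi> x) - (LINT x|\<mu>\<^sub>2. \<phi> x))
     else 0)"

lemma lipschitz_integrable:
  fixes \<phi> :: "'a::metric_space \<Rightarrow> real"
  assumes "compact (UNIV :: 'a set)" "L-lipschitz_on UNIV \<phi>" "\<mu> \<in> prob_measures"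
  shows "integrable \<mu> \<phi>"
proof -
  have s: "sets \<mu> = sets borel" and p: "prob_space \<mu>"
    using assms(3) by (auto simp: prob_measures_def)
  interpret prob_space \<mu> by (rule p)
  have c: "continuous_on UNIV \<phi>"
    using assms(2) by (rule lipschitz_on_continuous_on)
  have "bounded (range \<phi>)"
    using compact_continuous_image[OF c assms(1)] compact_imp_bounded by blast
  then obtain B where B: "\<And>x. norm (\<phi> x) \<le> B"
    by (auto simp: bounded_iff)
  have "\<phi> \<in> borel_measurable \<mu>"
    using borel_measurable_continuous_onI[OF c] s by (simp add: measurable_def sets_eq_imp_space_eq[OF s])
  then show ?thesis
    by (rule integrable_const_bound[rotated]) (use B in auto)
qed

lemma lipschitz_integral_diff_le:
  fixes \<phi> :: "'a::metric_space \<Rightarrow> real"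
  assumes "compact (UNIV :: 'a set)" "1-lipschitz_on UNIV \<phi>"
    "\<mu> \<in> prob_measures" "\<nu> \<in> prob_measures"
  shows "(LINT x|\<mu>. \<phi> x) - (LINT x|\<nu>. \<phi> x) \<le> 2 * diameter (UNIV :: 'a set)"
proof -
  define D where "D = diameter (UNIV :: 'a set)"
  have D: "dist x y \<le> D" for x y :: 'a
    using diameter_bounded_bound[OF compact_imp_bounded[OF assms(1)]] by (auto simp: D_def)
  have l: "\<bar>\<phi> x - \<phi> y\<bar> \<le> D" for x y
    using lipschitz_onD[OF assms(2), of x y] D[of x y] by (auto simp: dist_real_def)
  have *: "\<bar>(LINT x|\<rho>. \<phi> x) - \<phi> undefined\<bar> \<le> D" if "\<rho> \<in> prob_measures" for \<rho>
  proof -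
    have i: "integrable \<rho> \<phi>"
      using lipschitz_integrable[OF assms(1,2) that] .
    interpret prob_space \<rho> using that by (simp add: prob_measures_def)
    have "(LINT x|\<rho>. \<phi> x) \<le> \<phi> undefined + D"
      by (rule integral_le_const[OF i]) (use l in \<open>auto simp: abs_le_iff algebra_simps\<close>)
    moreover have "\<phi> undefined - D \<le> (LINT x|\<rho>. \<phi> x)"
      by (rule integral_ge_const[OF i]) (use l in \<open>auto simp: abs_le_iff algebra_simps\<close>)
    ultimately show ?thesis by auto
  qed
  show ?thesis
    using *[OF assms(3)] *[OF assms(4)] unfolding D_def[symmetric] by linarith
qed

lemma kant_dist_ge:
  fixes \<phi> :: "'a::metric_space \<Rightarrow> real"
  assumes "compact (UNIV :: 'a set)" "1-lipschitz_on UNIV \<phi>"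
    "\<mu> \<in> prob_measures" "\<nu> \<in> prob_measures"
  shows "(LINT x|\<mu>. \<phi> x) - (LINT x|\<nu>. \<phi> x) \<le> kant_dist \<mu> \<nu>"
  unfolding kant_dist_def using assms
  by (auto intro!: cSUP_upper bdd_aboveI[of _ "2 * diameter (UNIV :: 'a set)"]
      lipschitz_integral_diff_le)

lemma lipschitz_zero: "1-lipschitz_on UNIV (\<lambda>_::'a::metric_space. 0::real)"
  by (simp add: lipschitz_on_def)

lemma kant_dist_leI:
  assumes "\<mu> \<in> prob_measures" "\<nu> \<in> prob_measures"
    "\<And>\<phi> :: 'a::metric_space \<Rightarrow> real. 1-lipschitz_on UNIV \<phi> \<Longrightarrow>
       (LINT x|\<mu>. \<phi> x) - (LINT x|\<nu>. \<phi> x) \<le> B"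
  shows "kant_dist \<mu> \<nu> \<le> B"
  unfolding kant_dist_def using assms lipschitz_zero by (auto intro!: cSUP_least)

lemma kant_dist_eq_0_imp_eq:
  fixes \<mu> :: "'a::metric_space measure"
  assumes K: "compact (UNIV :: 'a set)" and M: "\<mu> \<in> prob_measures" "\<nu> \<in> prob_measures"
    and z: "\<And>\<phi> :: 'a \<Rightarrow> real. 1-lipschitz_on UNIV \<phi> \<Longrightarrow> (LINT x|\<mu>. \<phi> x) = (LINT x|\<nu>. \<phi> x)"
  shows "\<mu> = \<nu>"
proof -
  have s: "sets \<mu> = sets borel" "sets \<nu> = sets borel" and p: "prob_space \<mu>" "prob_space \<nu>"
    using M by (auto simp: prob_measures_def)
  interpret m: prob_space \<mu> by (rule p)
  interpret n: prob_space \<nu> by (rule p)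
  have closed_eq: "measure \<mu> C = measure \<nu> C" if C: "closed C" for C
  proof (cases "C = {}")
    case False
    define \<phi> where "\<phi> k x = max 0 (1 - real k * infdist x C)" for k :: nat and x :: 'a
    have lip: "(1 + real k)-lipschitz_on UNIV (\<phi> k)" for k
    proof (rule lipschitz_onI)
      fix x y :: 'a
      have "real k * \<bar>infdist x C - infdist y C\<bar> \<le> real k * dist x y"
        by (intro mult_left_mono infdist_triangle_abs) auto
      moreover have "\<bar>\<phi> k x - \<phi> k y\<bar> \<le> \<bar>real k * infdist x C - real k * infdist y C\<bar>"
        unfolding \<phi>_def by linarith
      moreover have "\<bar>real k * infdist x C - real k * infdist y C\<bar>
          = real k * \<bar>infdist x C - infdist y C\<bar>"
        by (metis abs_mult abs_of_nat right_diff_distrib)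
      ultimately have "\<bar>\<phi> k x - \<phi> k y\<bar> \<le> real k * dist x y" by linarith
      also have "\<dots> \<le> (1 + real k) * dist x y" by (intro mult_right_mono) auto
      finally show "dist (\<phi> k x) (\<phi> k y) \<le> (1 + real k) * dist x y"
        by (simp add: dist_real_def)
    qed auto
    have eq: "(LINT x|\<mu>. \<phi> k x) = (LINT x|\<nu>. \<phi> k x)" for k
    proof -
      have "1-lipschitz_on UNIV (\<lambda>x. inverse (1 + real k) * \<phi> k x)"
      proof (rule lipschitz_onI)
        fix x y
        have "dist (inverse (1 + real k) * \<phi> k x) (inverse (1 + real k) * \<phi> k y)
            = inverse (1 + real k) * dist (\<phi> k x) (\<phi> k y)"
          unfolding dist_real_def right_diff_distrib[symmetric] abs_mult by simp
        also have "\<dots> \<le> inverse (1 + real k) * ((1 + real k) * dist x y)"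
          using lipschitz_onD[OF lip, of x y k] by (intro mult_left_mono) auto
        finally show "dist (inverse (1 + real k) * \<phi> k x) (inverse (1 + real k) * \<phi> k y)
            \<le> 1 * dist x y"
          by (simp add: mult.assoc[symmetric])
      qed auto
      from z[OF this] show ?thesis by simp
    qed
    have lim: "(\<lambda>k. \<phi> k x) \<longlonglongrightarrow> indicator C x" for x
    proof (cases "x \<in> C")
      case True
      then show ?thesis by (simp add: \<phi>_def)
    next
      case xC: False
      then have pos: "0 < infdist x C"
        using infdist_pos_not_in_closed[OF C False] by simp
      obtain N :: nat where N: "1 / infdist x C < real N"
        using reals_Archimedean2 by blast
      have "\<phi> k x = 0" if "N \<le> k" for k
      proof -
        have "1 < real N * infdist x C" using N pos by (simp add: field_simps)
        also have "\<dots> \<le> real k * infdist x C" using that pos by (intro mult_right_mono) auto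
        finally show ?thesis by (simp add: \<phi>_def)
      qed
      then have "eventually (\<lambda>k. \<phi> k x = 0) sequentially"
        unfolding eventually_sequentially by blast
      then show ?thesis using xC by (simp add: tendsto_eventually)
    qed
    have conv: "(\<lambda>k. LINT x|\<rho>. \<phi> k x) \<longlonglongrightarrow> measure \<rho> C" if \<rho>: "\<rho> \<in> prob_measures" for \<rho>
    proof -
      have sr: "sets \<rho> = sets borel" using \<rho> by (simp add: prob_measures_def)
      interpret r: prob_space \<rho> using \<rho> by (simp add: prob_measures_def)
      have Cr: "C \<in> sets \<rho>" using C sr by simp
      have "(\<lambda>k. LINT x|\<rho>. \<phi> k x) \<longlonglongrightarrow> (LINT x|\<rho>. indicator C x)"
      proof (rule integral_dominated_convergence[where w = "\<lambda>_. 1"])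
        show "\<phi> k \<in> borel_measurable \<rho>" for k
          using lipschitz_integrable[OF K lip \<rho>] by (rule borel_measurable_integrable)
        show "AE x in \<rho>. norm (\<phi> k x) \<le> 1" for k
          by (auto simp: \<phi>_def infdist_nonneg)
      qed (use lim Cr in auto)
      then show ?thesis using Cr sets.sets_into_space[OF Cr] by (simp add: Int_absorb2)
    qed
    show ?thesis
      using LIMSEQ_unique[OF conv[OF M(1)]] conv[OF M(2)] eq by simp
  qed simp
  show ?thesis
  proof (rule measure_eqI_generator_eq[where E = "Collect closed" and \<Omega> = UNIV and A = "\<lambda>_. UNIV"])
    show "Int_stable (Collect closed)" by (auto simp: Int_stable_def)
    show "emeasure \<mu> X = emeasure \<nu> X" if "X \<in> Collect closed" for X
      using closed_eq that by (simp add: m.emeasure_eq_measure n.emeasure_eq_measure)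
    show "sets \<mu> = sigma_sets UNIV (Collect closed)" "sets \<nu> = sigma_sets UNIV (Collect closed)"
      using s by (simp_all add: borel_eq_closed)
  qed auto
qed

lemma Metric_space_prob_measures:
  assumes K: "compact (UNIV :: 'a::metric_space set)"
  shows "Metric_space (prob_measures :: 'a measure set) kant_dist"
proof
  fix \<mu> \<nu> :: "'a measure"
  have neg: "1-lipschitz_on UNIV (\<lambda>x. - \<phi> x)" if "1-lipschitz_on UNIV \<phi>" for \<phi> :: "'a \<Rightarrow> real"
    using that by (simp add: lipschitz_on_def dist_real_def abs_minus_commute)
  show nn: "0 \<le> kant_dist \<mu> \<nu>" for \<mu> \<nu> :: "'a measure"
    using kant_dist_ge[OF K lipschitz_zero, of \<mu> \<nu>]
    by (cases "\<mu> \<in> prob_measures \<and> \<nu> \<in> prob_measures") (auto simp: kant_dist_def)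
  have le: "kant_dist \<mu> \<nu> \<le> kant_dist \<nu> \<mu>" if "\<mu> \<in> prob_measures" "\<nu> \<in> prob_measures"
    for \<mu> \<nu> :: "'a measure"
  proof (rule kant_dist_leI[OF that])
    fix \<phi> :: "'a \<Rightarrow> real" assume "1-lipschitz_on UNIV \<phi>"
    from kant_dist_ge[OF K neg[OF this] that(2,1)]
    show "(LINT x|\<mu>. \<phi> x) - (LINT x|\<nu>. \<phi> x) \<le> kant_dist \<nu> \<mu>" by simp
  qed
  show "kant_dist \<mu> \<nu> = kant_dist \<nu> \<mu>"
    using le[of \<mu> \<nu>] le[of \<nu> \<mu>]
    by (cases "\<mu> \<in> prob_measures \<and> \<nu> \<in> prob_measures") (auto simp: kant_dist_def)
  assume M: "\<mu> \<in> prob_measures" "\<nu> \<in> prob_measures"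
  show "kant_dist \<mu> \<nu> = 0 \<longleftrightarrow> \<mu> = \<nu>"
  proof
    assume 0: "kant_dist \<mu> \<nu> = 0"
    show "\<mu> = \<nu>"
    proof (rule kant_dist_eq_0_imp_eq[OF K M])
      fix \<phi> :: "'a \<Rightarrow> real" assume "1-lipschitz_on UNIV \<phi>"
      from kant_dist_ge[OF K this M] kant_dist_ge[OF K neg[OF this] M] 0
      show "(LINT x|\<mu>. \<phi> x) = (LINT x|\<nu>. \<phi> x)" by simp
    qed
  next
    assume "\<mu> = \<nu>"
    then have "kant_dist \<mu> \<nu> \<le> 0" using M by (intro kant_dist_leI) auto
    with nn show "kant_dist \<mu> \<nu> = 0" by (simp add: order_antisym)
  qed
  fix \<rho> :: "'a measure" assume R: "\<rho> \<in> prob_measures"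
  show "kant_dist \<mu> \<rho> \<le> kant_dist \<mu> \<nu> + kant_dist \<nu> \<rho>"
  proof (rule kant_dist_leI[OF M(1) R])
    fix \<phi> :: "'a \<Rightarrow> real" assume "1-lipschitz_on UNIV \<phi>"
    from kant_dist_ge[OF K this M] kant_dist_ge[OF K this M(2) R]
    show "(LINT x|\<mu>. \<phi> x) - (LINT x|\<rho>. \<phi> x) \<le> kant_dist \<mu> \<nu> + kant_dist \<nu> \<rho>" by simp
  qed
qed

abbreviation prob_topology :: "'a::metric_space measure topology" where
  "prob_topology \<equiv> Metric_space.mtopology prob_measures kant_dist"

definition prob_borel :: "'a::metric_space measure measure" where
  "prob_borel = sigma prob_measures {U. openin prob_topology U}"

text \<open>For \<open>n = 0\<close> this is not a probability measure; only the limit in \<open>n\<close> is used.\<close>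

definition empirical_measure :: "('a::metric_space \<Rightarrow> 'a) \<Rightarrow> nat \<Rightarrow> 'a \<Rightarrow> 'a measure" where
  "empirical_measure f n x =
     measure_of UNIV (sets borel) (\<lambda>A. (\<Sum>k<n. emeasure (return borel ((f ^^ k) x)) A) / of_nat n)"

definition has_empirical_limit :: "('a::metric_space \<Rightarrow> 'a) \<Rightarrow> 'a \<Rightarrow> 'a measure \<Rightarrow> bool" where
  "has_empirical_limit f x \<nu> \<longleftrightarrow>
     limitin prob_topology (\<lambda>n. empirical_measure f n x) \<nu> sequentially"

definition empirical :: "('a::metric_space \<Rightarrow> 'a) \<Rightarrow> 'a measure \<Rightarrow> bool" where
  "empirical f \<mu> \<longleftrightarrow> (AE x in \<mu>. \<exists>\<nu>. has_empirical_limit f x \<nu>)"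

text \<open>On the set of points without empirical limit, a null set for an empirical system,
  the Dirac measure at the point serves as a dummy value.\<close>

definition empirical_limit :: "('a::metric_space \<Rightarrow> 'a) \<Rightarrow> 'a \<Rightarrow> 'a measure" where
  "empirical_limit f x =
     (if \<exists>\<nu>. has_empirical_limit f x \<nu> then THE \<nu>. has_empirical_limit f x \<nu> else return borel x)"

definition empirical_push :: "('a::metric_space \<Rightarrow> 'a) \<Rightarrow> 'a measure \<Rightarrow> 'a measure measure" where
  "empirical_push f \<mu> = distr \<mu> prob_borel (empirical_limit f)"

datatype scaling = Dim | Ord

definition abs_log :: "real \<Rightarrow> ereal" where
  "abs_log s = (if s = 0 then \<infinity> else ereal \<bar>ln s\<bar>)"

definition ext_log :: "ereal \<Rightarrow> ereal" where
  "ext_log a = (if a = \<infinity> then \<infinity> else if a = 0 then -\<infinity> else ereal (ln (real_of_ereal a)))"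

fun scl_quotient :: "scaling \<Rightarrow> (real \<Rightarrow> real) \<Rightarrow> real \<Rightarrow> ereal" where
  "scl_quotient Dim \<phi> \<epsilon> = abs_log (\<phi> \<epsilon>) / ereal \<bar>ln \<epsilon>\<bar>"
| "scl_quotient Ord \<phi> \<epsilon> = ext_log (abs_log (\<phi> \<epsilon>)) / ereal \<bar>ln \<epsilon>\<bar>"

text \<open>If \<open>\<phi> \<epsilon> = 1\<close> for all small \<open>\<epsilon>\<close>, then the quotient for \<^const>\<open>Ord\<close> is
  eventually \<open>-\<infinity>\<close>, and the orders are 0 by convention. For \<^const>\<open>Dim\<close> the
  value 0 is then the actual limit.\<close>

definition upper_scl :: "scaling \<Rightarrow> (real \<Rightarrow> real) \<Rightarrow> ereal" where
  "upper_scl S \<phi> =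
     (if \<forall>\<^sub>F \<epsilon> in at_right 0. \<phi> \<epsilon> = 1 then 0 else Limsup (at_right 0) (scl_quotient S \<phi>))"

definition lower_scl :: "scaling \<Rightarrow> (real \<Rightarrow> real) \<Rightarrow> ereal" where
  "lower_scl S \<phi> =
     (if \<forall>\<^sub>F \<epsilon> in at_right 0. \<phi> \<epsilon> = 1 then 0 else Liminf (at_right 0) (scl_quotient S \<phi>))"

definition upper_local_scl ::
  "scaling \<Rightarrow> 'b set \<Rightarrow> ('b \<Rightarrow> 'b \<Rightarrow> real) \<Rightarrow> 'b measure \<Rightarrow> 'b \<Rightarrow> ereal" where
  "upper_local_scl S Y d \<nu> y = upper_scl S (\<lambda>\<epsilon>. measure \<nu> (Metric_space.mball Y d y \<epsilon>))"

definition lower_local_scl ::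
  "scaling \<Rightarrow> 'b set \<Rightarrow> ('b \<Rightarrow> 'b \<Rightarrow> real) \<Rightarrow> 'b measure \<Rightarrow> 'b \<Rightarrow> ereal" where
  "lower_local_scl S Y d \<nu> y = lower_scl S (\<lambda>\<epsilon>. measure \<nu> (Metric_space.mball Y d y \<epsilon>))"

text \<open>Local scales of a probability measure are nonnegative: for \<^const>\<open>Ord\<close>, the mass of
  \<open>B(y, \<epsilon>)\<close> is monotone in \<open>\<epsilon>\<close>, so unless it is constantly 1 it stays below some
  constant smaller than 1 for small \<open>\<epsilon>\<close>. Hence \<^const>\<open>e2ennreal\<close> loses nothing.\<close>

definition upper_local_emergence ::
  "scaling \<Rightarrow> ('a::metric_space \<Rightarrow> 'a) \<Rightarrow> 'a measure \<Rightarrow> ennreal" where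
  "upper_local_emergence S f \<mu> =
     (\<integral>\<^sup>+ \<nu>. e2ennreal (upper_local_scl S prob_measures kant_dist (empirical_push f \<mu>) \<nu>)
        \<partial>(empirical_push f \<mu>))"

definition lower_local_emergence ::
  "scaling \<Rightarrow> ('a::metric_space \<Rightarrow> 'a) \<Rightarrow> 'a measure \<Rightarrow> ennreal" where
  "lower_local_emergence S f \<mu> =
     (\<integral>\<^sup>+ \<nu>. e2ennreal (lower_local_scl S prob_measures kant_dist (empirical_push f \<mu>) \<nu>)
        \<partial>(empirical_push f \<mu>))"

end

theory Submission
  imports Defs "HOL-Real_Asymp.Real_Asymp"
begin

text \<open>Write \<open>P\<^sub>o\<close>, \<open>P\<^sub>1\<close>, \<open>Q\<close> for the laws of the empirical limit under
\<open>\<mu>\<^sub>o\<close>, \<open>\<mu>\<^sub>1\<close>, \<open>\<mu>\<close>. Then \<open>Q = t P\<^sub>o + (1 - t) P\<^sub>1\<close>, so integrating the local scale of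
\<open>Q\<close> against \<open>Q\<close> splits as wanted, and it remains to see that for \<open>P\<^sub>o\<close>-almost every \<open>y\<close>
the local scales of \<open>P\<^sub>o\<close> and of \<open>Q\<close> at \<open>y\<close> agree, and likewise for \<open>P\<^sub>1\<close>.

The scale of \<open>Q\<close> is at most that of \<open>P\<^sub>o\<close> everywhere because \<open>Q \<ge> t P\<^sub>o\<close>. For the converse
inequality one would like to differentiate measures, but the space of probability measures is in
general infinite dimensional, where the Lebesgue density theorem can fail. The scales only see
ball masses up to subexponential factors and a bounded change of radius, and at that precision a Fubini argument
suffices: for any two probability measures \<open>P\<close>, \<open>Q\<close> on a metric space, the mean of
\<open>Q (B(y, r)) / P (B(y, 2 r))\<close> for \<open>y\<close> distributed according to \<open>P\<close> is at most \<open>1\<close>,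
since for \<open>d x y < r\<close> the ball \<open>B(y, 2r)\<close> contains \<open>B(x, r)\<close>
(\<open>nn_integral_ball_ratio_le_1\<close>). Summing over the radii \<open>exp (- n)\<close> with weights of order
\<open>1 / n\<^sup>2\<close> bounds the ratio, for \<open>P\<close>-almost every \<open>y\<close>, by a power of the logarithm of the
radius (\<open>AE_mball_comparison\<close>), and such a factor changes neither dimension nor order
(\<open>scl_mono\<close>).

The argument needs the law of the empirical limit to be a probability measure on the Borel sets
of the Kantorovich--Wasserstein distance, hence the empirical limit to be a Borel map. The points
where the empirical measures converge form a Borel set because they are those where the empirical
measures are Cauchy; this is completeness of the space of probability measures
(\<open>mcomplete_prob_measures\<close>), which rests on a Riesz representation theorem on compact metric
spaces. Total boundedness of the set of \<open>1\<close>-Lipschitz functions modulo constants turns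
measurability questions about the distance into questions about countably many integrals.

The local scales are treated as arbitrary functions: the integral of any function, a supremum over
simple minorants, is linear in the measure (\<open>nn_integral_mixture\<close>).\<close>

section \<open>Comparing scales of two functions\<close>

text \<open>Both scaling quotients compare \<open>- ln (\<phi> \<epsilon>)\<close> with a growth function of \<open>- ln \<epsilon>\<close>: a multiple of
it for dimensions, the exponential of a multiple for orders.\<close>

definition scl_gauge :: "scaling \<Rightarrow> real \<Rightarrow> real" where
  "scl_gauge S b = (case S of Dim \<Rightarrow> b | Ord \<Rightarrow> exp b)"

lemma scl_quotient_less_iff:
  assumes "0 \<le> \<phi> \<epsilon>" "\<phi> \<epsilon> \<le> 1" "0 < \<epsilon>" "\<epsilon> < 1"
  shows "scl_quotient S \<phi> \<epsilon> < ereal b \<longleftrightarrow> 0 < \<phi> \<epsilon> \<and> - ln (\<phi> \<epsilon>) < scl_gauge S (b * - ln \<epsilon>)"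
proof -
  have L: "0 < - ln \<epsilon>" using assms by simp
  consider "\<phi> \<epsilon> = 0" | "\<phi> \<epsilon> = 1" | "0 < \<phi> \<epsilon>" "0 < - ln (\<phi> \<epsilon>)"
    using assms by (cases "\<phi> \<epsilon> = 0"; cases "\<phi> \<epsilon> = 1") auto
  then show ?thesis
  proof cases
    case 1
    then show ?thesis using L by (cases S) (auto simp: abs_log_def ext_log_def)
  next
    case 2
    then show ?thesis using L
      by (cases S) (auto simp: abs_log_def ext_log_def scl_gauge_def zero_ereal_def[symmetric]
          mult_less_0_iff)
  next
    case 3
    define a L where "a = - ln (\<phi> \<epsilon>)" and "L = - ln \<epsilon>"
    have "0 < a" "0 < L" "abs_log (\<phi> \<epsilon>) = ereal a" "\<bar>ln \<epsilon>\<bar> = L"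
      using 3 assms L by (auto simp: a_def L_def abs_log_def)
    moreover have "ln a < b * L \<longleftrightarrow> a < exp (b * L)"
      using \<open>0 < a\<close> by (metis exp_less_cancel_iff exp_ln)
    ultimately show ?thesis unfolding a_def[symmetric] L_def[symmetric]
      using 3 by (cases S) (auto simp: ext_log_def scl_gauge_def pos_divide_less_eq)
  qed
qed

text \<open>Passing to a larger rate leaves room for a shift of \<open>L = - ln \<epsilon>\<close> (a change of the radius by a
constant factor) and for \<open>3 * ln L\<close> (a factor \<open>L ^ 3\<close> in the mass).\<close>

lemma scl_gauge_absorbs:
  assumes "0 \<le> b" "b < b'"
  shows "\<forall>\<^sub>F L in at_top. scl_gauge S (b * (L + k)) + 3 * ln L \<le> scl_gauge S (b' * L)"
proof (cases S)
  case Dim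
  have "\<forall>\<^sub>F L in at_top. b * (L + k) + 3 * ln L \<le> b' * L" using assms by real_asymp
  then show ?thesis by (simp add: Dim scl_gauge_def)
next
  case Ord
  have "\<forall>\<^sub>F L in at_top. exp (b * (L + k)) + 3 * ln L \<le> exp (b' * L)"
    using assms by (cases "b = 0") real_asymp+
  then show ?thesis by (simp add: Ord scl_gauge_def)
qed

lemma scl_quotient_transfer:
  fixes \<phi> \<psi> :: "real \<Rightarrow> real"
  assumes \<phi>: "\<And>\<epsilon>. 0 \<le> \<phi> \<epsilon>" "\<And>\<epsilon>. \<phi> \<epsilon> \<le> 1" and \<psi>: "\<And>\<epsilon>. 0 \<le> \<psi> \<epsilon>" "\<And>\<epsilon>. \<psi> \<epsilon> \<le> 1"
    and c: "0 < c" "c \<le> 1"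
    and le: "\<forall>\<^sub>F \<epsilon> in at_right 0. \<phi> (c * \<epsilon>) \<le> (- ln \<epsilon>) ^ 3 * \<psi> \<epsilon>"
    and b: "0 \<le> b" "b < b'"
  shows "\<forall>\<^sub>F \<epsilon> in at_right 0. scl_quotient S \<phi> (c * \<epsilon>) < ereal b \<longrightarrow> scl_quotient S \<psi> \<epsilon> < ereal b'"
proof -
  have "filterlim (\<lambda>\<epsilon>::real. - ln \<epsilon>) at_top (at_right 0)" by real_asymp
  from eventually_compose_filterlim[OF scl_gauge_absorbs[OF b, of S "- ln c"] this]
  have g: "\<forall>\<^sub>F \<epsilon> in at_right 0.
      scl_gauge S (b * (- ln \<epsilon> + - ln c)) + 3 * ln (- ln \<epsilon>) \<le> scl_gauge S (b' * - ln \<epsilon>)" .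
  have "\<forall>\<^sub>F \<epsilon> in at_right (0::real). 0 < \<epsilon> \<and> \<epsilon> < 1"
    by (intro eventually_conj eventually_at_right_less eventually_at_rightI[of 0 1]) auto
  then show ?thesis using g le
  proof eventually_elim
    case (elim \<epsilon>)
    then have \<epsilon>: "0 < \<epsilon>" "\<epsilon> < 1" "0 < - ln \<epsilon>" by auto
    have c\<epsilon>: "0 < c * \<epsilon>" "c * \<epsilon> < 1" "ln (c * \<epsilon>) = ln c + ln \<epsilon>"
      using c \<epsilon> mult_le_one[of c \<epsilon>] by (auto simp: ln_mult intro: le_less_trans[of _ "1 * \<epsilon>"] mult_right_mono)
    show ?case
    proof
      assume "scl_quotient S \<phi> (c * \<epsilon>) < ereal b"
      then have *: "0 < \<phi> (c * \<epsilon>)" "- ln (\<phi> (c * \<epsilon>)) < scl_gauge S (b * (- ln \<epsilon> + - ln c))"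
        using scl_quotient_less_iff[of \<phi> "c * \<epsilon>" S b] \<phi> c\<epsilon> by (auto simp: algebra_simps)
      have pos: "0 < (- ln \<epsilon>) ^ 3 * \<psi> \<epsilon>" using * elim(3) by linarith
      then have "0 < \<psi> \<epsilon>" using \<psi>(1)[of \<epsilon>] by (cases "\<psi> \<epsilon> = 0") auto
      moreover have "ln (\<phi> (c * \<epsilon>)) \<le> ln ((- ln \<epsilon>) ^ 3 * \<psi> \<epsilon>)"
        using * pos elim(3) by simp
      then have "ln (\<phi> (c * \<epsilon>)) \<le> 3 * ln (- ln \<epsilon>) + ln (\<psi> \<epsilon>)"
        using \<epsilon>(3) calculation by (subst (asm) ln_mult_pos) (auto simp only: ln_realpow zero_less_power of_nat_numeral)
      ultimately show "scl_quotient S \<psi> \<epsilon> < ereal b'"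
        using scl_quotient_less_iff[of \<psi> \<epsilon> S b'] \<psi> \<epsilon> * elim(2) by auto
    qed
  qed
qed

text \<open>Comparing two extended reals up to their negative parts only takes nonnegative thresholds, the
ones for which \<open>scl_gauge_absorbs\<close> is available.\<close>

lemma e2ennreal_mono_threshold:
  assumes "\<And>b b'. 0 \<le> b \<Longrightarrow> b < b' \<Longrightarrow> y < ereal b \<Longrightarrow> x \<le> ereal b'"
  shows "e2ennreal x \<le> e2ennreal y"
proof (rule ccontr)
  assume "\<not> ?thesis"
  then have "e2ennreal y < e2ennreal x" by simp
  then have *: "max 0 y < x"
    by (metis e2ennreal_mono e2ennreal_neg linorder_not_less max_def not_less_zero)
  then obtain b' where b': "max 0 y < ereal b'" "ereal b' < x" using ereal_dense2 by blast
  then obtain b where b: "max 0 y < ereal b" "ereal b < ereal b'" using ereal_dense2 by blast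
  have "x \<le> ereal b'" using b b' by (intro assms[of b]) (auto simp: zero_ereal_def max_less_iff_conj simp del: zero_ereal_def[symmetric])
  with b' show False by simp
qed

lemma Limsup_scl_quotient_nonpos:
  assumes "\<forall>\<^sub>F \<epsilon> in at_right 0. \<phi> \<epsilon> = 1"
  shows "Limsup (at_right 0) (scl_quotient S \<phi>) \<le> 0"
proof (rule Limsup_bounded)
  have "\<forall>\<^sub>F \<epsilon> in at_right (0::real). \<epsilon> < 1" by (rule eventually_at_rightI[of 0 1]) auto
  with assms eventually_at_right_less
  show "\<forall>\<^sub>F \<epsilon> in at_right 0. scl_quotient S \<phi> \<epsilon> \<le> 0"
    by eventually_elim (cases S; auto simp: abs_log_def ext_log_def zero_ereal_def)
qed

text \<open>The convention for functions that are eventually \<open>1\<close> replaces a nonpositive value by \<open>0\<close>, and is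
thus invisible after \<^const>\<open>e2ennreal\<close>.\<close>

lemma
  shows e2ennreal_upper_scl:
      "e2ennreal (upper_scl S \<phi>) = e2ennreal (Limsup (at_right 0) (scl_quotient S \<phi>))"
    and e2ennreal_lower_scl:
      "e2ennreal (lower_scl S \<phi>) = e2ennreal (Liminf (at_right 0) (scl_quotient S \<phi>))"
proof -
  have le: "Liminf (at_right 0) (scl_quotient S \<phi>) \<le> Limsup (at_right 0) (scl_quotient S \<phi>)"
    by (intro Liminf_le_Limsup) simp
  show "e2ennreal (upper_scl S \<phi>) = e2ennreal (Limsup (at_right 0) (scl_quotient S \<phi>))"
    using Limsup_scl_quotient_nonpos[of \<phi> S] by (auto simp: upper_scl_def e2ennreal_neg)
  show "e2ennreal (lower_scl S \<phi>) = e2ennreal (Liminf (at_right 0) (scl_quotient S \<phi>))"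
    using Limsup_scl_quotient_nonpos[of \<phi> S] order_trans[OF le]
    by (auto simp: lower_scl_def e2ennreal_neg)
qed

lemma
  fixes g :: "real \<Rightarrow> 'b::complete_linorder"
  assumes "0 < c"
  shows Limsup_at_right_rescale: "Limsup (at_right 0) (\<lambda>\<epsilon>. g (c * \<epsilon>)) = Limsup (at_right 0) g"
    and Liminf_at_right_rescale: "Liminf (at_right 0) (\<lambda>\<epsilon>. g (c * \<epsilon>)) = Liminf (at_right 0) g"
proof -
  have inj: "inj ((*) c)" using assms by (auto simp: inj_def)
  have F: "filtermap ((*) c) (at_right 0) = at_right 0"
    using filtermap_times_pos_at_right[OF assms, of 0] by simp
  show "Limsup (at_right 0) (\<lambda>\<epsilon>. g (c * \<epsilon>)) = Limsup (at_right 0) g"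
    using Limsup_filtermap_eq[OF inj, of "at_right 0" g] by (simp add: F)
  show "Liminf (at_right 0) (\<lambda>\<epsilon>. g (c * \<epsilon>)) = Liminf (at_right 0) g"
    using Liminf_filtermap_eq[OF inj, of "at_right 0" g] by (simp add: F)
qed

text \<open>The scales are unchanged by a constant factor \<open>c\<close> in the radius, and a factor polynomial in
\<open>- ln \<epsilon>\<close> is negligible for both of them: the exponent \<open>3\<close> stands for any fixed power.\<close>

lemma scl_mono:
  fixes \<phi> \<psi> :: "real \<Rightarrow> real"
  assumes \<phi>: "\<And>\<epsilon>. 0 \<le> \<phi> \<epsilon>" "\<And>\<epsilon>. \<phi> \<epsilon> \<le> 1" and \<psi>: "\<And>\<epsilon>. 0 \<le> \<psi> \<epsilon>" "\<And>\<epsilon>. \<psi> \<epsilon> \<le> 1"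
    and c: "0 < c" "c \<le> 1"
    and le: "\<forall>\<^sub>F \<epsilon> in at_right 0. \<phi> (c * \<epsilon>) \<le> (- ln \<epsilon>) ^ 3 * \<psi> \<epsilon>"
  shows "e2ennreal (upper_scl S \<psi>) \<le> e2ennreal (upper_scl S \<phi>)"
    and "e2ennreal (lower_scl S \<psi>) \<le> e2ennreal (lower_scl S \<phi>)"
proof -
  note tr = scl_quotient_transfer[where S = S, OF \<phi> \<psi> c le]
  show "e2ennreal (upper_scl S \<psi>) \<le> e2ennreal (upper_scl S \<phi>)"
    unfolding e2ennreal_upper_scl
  proof (rule e2ennreal_mono_threshold)
    fix b b' :: real
    assume b: "0 \<le> b" "b < b'" and "Limsup (at_right 0) (scl_quotient S \<phi>) < ereal b"
    then have "Limsup (at_right 0) (\<lambda>\<epsilon>. scl_quotient S \<phi> (c * \<epsilon>)) < ereal b"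
      by (simp add: Limsup_at_right_rescale[OF c(1)])
    from Limsup_lessD[OF this] tr[OF b]
    have "\<forall>\<^sub>F \<epsilon> in at_right 0. scl_quotient S \<psi> \<epsilon> \<le> ereal b'"
      by eventually_elim auto
    then show "Limsup (at_right 0) (scl_quotient S \<psi>) \<le> ereal b'" by (rule Limsup_bounded)
  qed
  show "e2ennreal (lower_scl S \<psi>) \<le> e2ennreal (lower_scl S \<phi>)"
    unfolding e2ennreal_lower_scl
  proof (rule e2ennreal_mono_threshold, rule ccontr)
    fix b b' :: real
    assume b: "0 \<le> b" "b < b'" and less: "Liminf (at_right 0) (scl_quotient S \<phi>) < ereal b"
      and "\<not> Liminf (at_right 0) (scl_quotient S \<psi>) \<le> ereal b'"
    then have "ereal b' < Liminf (at_right 0) (scl_quotient S \<psi>)" by simp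
    from less_LiminfD[OF this] tr[OF b]
    have "\<forall>\<^sub>F \<epsilon> in at_right 0. ereal b \<le> scl_quotient S \<phi> (c * \<epsilon>)"
      by eventually_elim auto
    then have "ereal b \<le> Liminf (at_right 0) (\<lambda>\<epsilon>. scl_quotient S \<phi> (c * \<epsilon>))"
      by (rule Liminf_bounded)
    with less show False by (simp add: Liminf_at_right_rescale[OF c(1)])
  qed
qed

section \<open>Comparing ball masses of two probability measures\<close>

lemma (in Metric_space)
  assumes N: "space N = M" and P: "space P = M" "sigma_finite_measure P"
    and d: "case_prod d \<in> borel_measurable (N \<Otimes>\<^sub>M P)"
  shows sets_mball: "y \<in> M \<Longrightarrow> mball y s \<in> sets P"
    and measurable_emeasure_mball: "(\<lambda>y. emeasure P (mball y s)) \<in> borel_measurable N"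
proof -
  interpret P: sigma_finite_measure P by fact
  let ?E = "{z \<in> space (N \<Otimes>\<^sub>M P). d (fst z) (snd z) < s}"
  have E: "?E \<in> sets (N \<Otimes>\<^sub>M P)"
    using d by (simp add: case_prod_beta')
  have ball: "Pair y -` ?E = mball y s" if "y \<in> M" for y
    using that by (auto simp: space_pair_measure N P)
  show "y \<in> M \<Longrightarrow> mball y s \<in> sets P"
    using sets_Pair1[OF E, of y] ball by simp
  show "(\<lambda>y. emeasure P (mball y s)) \<in> borel_measurable N"
    using P.measurable_emeasure_Pair[OF E]
    by (rule measurable_cong[THEN iffD1, rotated]) (simp add: ball N del: vimage_Collect_eq)
qed

lemma ennreal_inverse_antimono: "x \<le> y \<Longrightarrow> inverse y \<le> inverse (x::ennreal)"
  using ereal_inverse_antimono[of "enn2ereal x" "enn2ereal y"]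
  by (simp add: less_eq_ennreal.rep_eq inverse_ennreal.rep_eq)

text \<open>Write \<open>Q (B(y, r))\<close> as an integral over \<open>x\<close> and exchange the integrals. For fixed \<open>x\<close> the inner
integral runs over \<open>y \<in> B(x, r)\<close>, where \<open>B(x, r) \<subseteq> B(y, 2 * r)\<close> bounds the integrand by
\<open>1 / P (B(x, r))\<close>.\<close>

lemma (in Metric_space) nn_integral_ball_ratio_le_1:
  assumes P: "prob_space P" and Q: "prob_space Q"
    and sp: "space P = M" "space Q = M"
    and d: "case_prod d \<in> borel_measurable (P \<Otimes>\<^sub>M Q)" "case_prod d \<in> borel_measurable (P \<Otimes>\<^sub>M P)"
  shows "(\<integral>\<^sup>+ y. emeasure Q (mball y r) * inverse (emeasure P (mball y (2 * r))) \<partial>P) \<le> 1"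
proof -
  interpret P: prob_space P by fact
  interpret Q: prob_space Q by fact
  interpret PQ: pair_sigma_finite P Q ..
  note mP [measurable] = measurable_emeasure_mball[OF sp(1) sp(1) P.sigma_finite_measure_axioms d(2)]
  note msP = sets_mball[OF sp(1) sp(1) P.sigma_finite_measure_axioms d(2)]
  note msQ = sets_mball[OF sp(1) sp(2) Q.sigma_finite_measure_axioms d(1)]
  have [measurable]: "{z \<in> space (P \<Otimes>\<^sub>M Q). d (fst z) (snd z) < r} \<in> sets (P \<Otimes>\<^sub>M Q)"
    using d(1) by (simp add: case_prod_beta')
  let ?I = "\<lambda>y x. indicator {z \<in> space (P \<Otimes>\<^sub>M Q). d (fst z) (snd z) < r} (y, x) * inverse (emeasure P (mball y (2 * r)))"
  have I: "case_prod ?I \<in> borel_measurable (P \<Otimes>\<^sub>M Q)" by measurable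
  have "(\<integral>\<^sup>+ y. emeasure Q (mball y r) * inverse (emeasure P (mball y (2 * r))) \<partial>P)
      = (\<integral>\<^sup>+ y. (\<integral>\<^sup>+ x. ?I y x \<partial>Q) \<partial>P)"
  proof (rule nn_integral_cong)
    fix y assume y: "y \<in> space P"
    have "(\<integral>\<^sup>+ x. ?I y x \<partial>Q) = (\<integral>\<^sup>+ x. inverse (emeasure P (mball y (2 * r))) * indicator (mball y r) x \<partial>Q)"
      using y sp by (intro nn_integral_cong) (auto simp: space_pair_measure split: split_indicator)
    then show "emeasure Q (mball y r) * inverse (emeasure P (mball y (2 * r))) = (\<integral>\<^sup>+ x. ?I y x \<partial>Q)"
      using msQ[of y r] y[unfolded sp] by (simp only: nn_integral_cmult_indicator) (simp add: mult.commute)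
  qed
  also have "\<dots> = (\<integral>\<^sup>+ x. (\<integral>\<^sup>+ y. ?I y x \<partial>P) \<partial>Q)"
    by (rule PQ.Fubini'[OF I, symmetric])
  also have "\<dots> \<le> (\<integral>\<^sup>+ x. 1 \<partial>Q)"
  proof (rule nn_integral_mono)
    fix x assume x: "x \<in> space Q"
    have "(\<integral>\<^sup>+ y. ?I y x \<partial>P) \<le> (\<integral>\<^sup>+ y. inverse (emeasure P (mball x r)) * indicator (mball x r) y \<partial>P)"
    proof (rule nn_integral_mono)
      fix y assume y: "y \<in> space P"
      show "?I y x \<le> inverse (emeasure P (mball x r)) * indicator (mball x r) y"
      proof (cases "d y x < r")
        case True
        have "mball x r \<subseteq> mball y (2 * r)"
        proof
          fix z assume "z \<in> mball x r"
          then show "z \<in> mball y (2 * r)" using True triangle[of y x z] x y sp by auto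
        qed
        then have "emeasure P (mball x r) \<le> emeasure P (mball y (2 * r))"
          using msP[of y] y sp by (intro emeasure_mono) auto
        then show ?thesis using True x y sp
          by (auto simp: commute space_pair_measure intro!: ennreal_inverse_antimono split: split_indicator)
      qed (auto split: split_indicator)
    qed
    also have "\<dots> = inverse (emeasure P (mball x r)) * emeasure P (mball x r)"
      using msP[of x r] x sp by (simp add: nn_integral_cmult_indicator)
    also have "\<dots> \<le> 1"
      by (cases "measure P (mball x r) = 0")
        (auto simp: P.emeasure_eq_measure ennreal_mult[symmetric] inverse_ennreal zero_less_measure_iff)
    finally show "(\<integral>\<^sup>+ y. ?I y x \<partial>P) \<le> 1" .
  qed
  also have "\<dots> = 1" by (simp add: Q.emeasure_space_1)
  finally show ?thesis .
qed

text \<open>The weights \<open>w n\<close> are summable, so \<open>w n\<close> times the ratio of ball masses at radius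
\<open>exp (- n)\<close> is almost surely bounded in \<open>n\<close>. Their polynomial decay is what keeps the loss
logarithmic in the radius. Rounding a radius to some \<open>exp (- n)\<close> costs the factor \<open>exp (- 2)\<close>.\<close>

lemma (in Metric_space) AE_mball_comparison:
  assumes P: "prob_space P" and Q: "prob_space Q"
    and sp: "space P = M" "space Q = M"
    and d: "case_prod d \<in> borel_measurable (P \<Otimes>\<^sub>M Q)" "case_prod d \<in> borel_measurable (P \<Otimes>\<^sub>M P)"
  shows "AE y in P. \<forall>\<^sub>F \<epsilon> in at_right 0.
    measure Q (mball y (exp (-2) * \<epsilon>)) \<le> (- ln \<epsilon>) ^ 3 * measure P (mball y \<epsilon>)"
proof -
  interpret P: prob_space P by fact
  interpret Q: prob_space Q by fact
  define w :: "nat \<Rightarrow> real" where "w n = inverse (real (Suc n) ^ 2)" for n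
  have w: "0 < w n" for n by (simp add: w_def)
  define g where "g n y = emeasure Q (mball y (exp (- real n))) * inverse (emeasure P (mball y (2 * exp (- real n))))"
    for n y
  note [measurable] = measurable_emeasure_mball[OF sp(1) sp(1) P.sigma_finite_measure_axioms d(2)]
    measurable_emeasure_mball[OF sp(1) sp(2) Q.sigma_finite_measure_axioms d(1)]
  have g [measurable]: "g n \<in> borel_measurable P" for n
    unfolding g_def by measurable
  have "(\<integral>\<^sup>+ y. (\<Sum>n. w n * g n y) \<partial>P) = (\<Sum>n. w n * (\<integral>\<^sup>+ y. g n y \<partial>P))"
    by (simp add: nn_integral_suminf nn_integral_cmult)
  also have "\<dots> \<le> (\<Sum>n. ennreal (w n))"
  proof (intro suminf_le)
    fix n
    have "(\<integral>\<^sup>+ y. g n y \<partial>P) \<le> 1"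
      unfolding g_def by (rule nn_integral_ball_ratio_le_1[OF P Q sp d])
    from mult_left_mono[OF this, of "ennreal (w n)"]
    show "w n * (\<integral>\<^sup>+ y. g n y \<partial>P) \<le> ennreal (w n)" by simp
  qed auto
  also have "\<dots> < \<infinity>"
  proof -
    have "summable w" unfolding w_def
      using inverse_power_summable[of 2, where 'a = real] summable_Suc_iff[of "\<lambda>n. inverse (real n ^ 2)"] by simp
    then show ?thesis using w by (simp add: suminf_ennreal_eq less_imp_le ennreal_suminf_neq_top less_top)
  qed
  finally have "AE y in P. (\<Sum>n. w n * g n y) \<noteq> \<infinity>"
    by (intro nn_integral_PInf_AE) auto
  then show ?thesis
  proof (rule AE_mp[OF _ AE_I2], intro impI)
    fix y assume "y \<in> space P" and fin: "(\<Sum>n. w n * g n y) \<noteq> \<infinity>"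
    then obtain C where C: "0 \<le> C" "(\<Sum>n. w n * g n y) = ennreal C"
      by (cases "\<Sum>n. w n * g n y") auto
    have le: "measure Q (mball y (exp (- real n))) \<le> C * real (Suc n) ^ 2 * measure P (mball y (2 * exp (- real n)))" for n
    proof -
      have 1: "w n * g n y \<le> ennreal C"
        unfolding C(2)[symmetric] using sum_le_suminf[of "\<lambda>n. w n * g n y" "{n}"] by simp
      show ?thesis
      \<comment> \<open>A null denominator makes the ratio infinite unless the numerator vanishes as well.\<close>
      proof (cases "measure P (mball y (2 * exp (- real n))) = 0")
        case True
        then have "measure Q (mball y (exp (- real n))) = 0"
          using 1 w[of n] by (cases "measure Q (mball y (exp (- real n))) = 0")
            (auto simp: g_def P.emeasure_eq_measure Q.emeasure_eq_measure ennreal_mult_top ennreal_top_mult top_unique)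
        then show ?thesis using True by simp
      next
        case False
        then have pos: "0 < measure P (mball y (2 * exp (- real n)))" by (simp add: zero_less_measure_iff)
        have "w n * (measure Q (mball y (exp (- real n))) / measure P (mball y (2 * exp (- real n)))) \<le> C"
          using 1 C pos w[of n] by (simp add: g_def P.emeasure_eq_measure Q.emeasure_eq_measure inverse_ennreal
              ennreal_mult[symmetric] divide_inverse less_imp_le)
        then show ?thesis using pos by (simp add: w_def field_simps)
      qed
    qed
    have "filterlim (\<lambda>\<epsilon>::real. - ln \<epsilon>) at_top (at_right 0)" by real_asymp
    moreover have "\<forall>\<^sub>F L in at_top. C * (L + 3) ^ 2 \<le> L ^ 3" by real_asymp
    ultimately have "\<forall>\<^sub>F \<epsilon> in at_right 0. C * (- ln \<epsilon> + 3) ^ 2 \<le> (- ln \<epsilon>) ^ 3"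
      by (rule eventually_compose_filterlim[rotated])
    moreover have "\<forall>\<^sub>F \<epsilon> in at_right (0::real). 0 < \<epsilon> \<and> \<epsilon> < 1"
      by (intro eventually_conj eventually_at_right_less eventually_at_rightI[of 0 1]) auto
    ultimately show "\<forall>\<^sub>F \<epsilon> in at_right 0.
      measure Q (mball y (exp (-2) * \<epsilon>)) \<le> (- ln \<epsilon>) ^ 3 * measure P (mball y \<epsilon>)"
    proof eventually_elim
      case (elim \<epsilon>)
      then have \<epsilon>: "0 < \<epsilon>" "0 < - ln \<epsilon>" by auto
      \<comment> \<open>The least integer with \<open>exp (- n) \<le> \<epsilon> / exp 1\<close>, which leaves room for the factor \<open>2 \<le> exp 1\<close>.\<close>
      define n where "n = nat \<lceil>- ln \<epsilon> + 1\<rceil>"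
      have n: "- ln \<epsilon> + 1 \<le> real n" "real n \<le> - ln \<epsilon> + 2"
        using \<epsilon> unfolding n_def by linarith+
      have "exp (-2) * \<epsilon> = exp (ln \<epsilon> - 2)" using \<epsilon> by (simp add: exp_diff exp_minus field_simps)
      also have "\<dots> \<le> exp (- real n)" using n by simp
      finally have 1: "exp (-2) * \<epsilon> \<le> exp (- real n)" .
      have "2 * exp (- real n) \<le> exp 1 * exp (ln \<epsilon> - 1)"
        using n exp_ge_add_one_self[of 1] by (intro mult_mono) auto
      also have "\<dots> = \<epsilon>" using \<epsilon> by (simp add: exp_diff)
      finally have 2: "2 * exp (- real n) \<le> \<epsilon>" .
      have y: "y \<in> M" using \<open>y \<in> space P\<close> sp by simp
      have "measure Q (mball y (exp (-2) * \<epsilon>)) \<le> measure Q (mball y (exp (- real n)))"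
        using 1 sets_mball[OF sp(1) sp(2) Q.sigma_finite_measure_axioms d(1) y]
        by (intro Q.finite_measure_mono mball_subset_concentric) auto
      also note le[of n]
      also have "C * real (Suc n) ^ 2 * measure P (mball y (2 * exp (- real n))) \<le> (- ln \<epsilon>) ^ 3 * measure P (mball y \<epsilon>)"
      proof (rule mult_mono)
        have "C * real (Suc n) ^ 2 \<le> C * (- ln \<epsilon> + 3) ^ 2"
          using n C by (intro mult_left_mono power_mono) auto
        with elim show "C * real (Suc n) ^ 2 \<le> (- ln \<epsilon>) ^ 3" by linarith
        show "measure P (mball y (2 * exp (- real n))) \<le> measure P (mball y \<epsilon>)"
          using 2 sets_mball[OF sp(1) sp(1) P.sigma_finite_measure_axioms d(2) y]
          by (intro P.finite_measure_mono mball_subset_concentric) auto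
        show "0 \<le> (- ln \<epsilon>) ^ 3" using \<epsilon> by (intro zero_le_power) simp
      qed simp
      finally show ?case .
    qed
  qed
qed

section \<open>Integrals against a mixture\<close>

text \<open>The integral of an arbitrary function is the supremum of the integrals of its simple minorants,
and countably many of them approach it.\<close>

lemma nn_integral_measurable_minorant:
  fixes F :: "'a \<Rightarrow> ennreal"
  obtains g where "g \<in> borel_measurable M" "g \<le> F" "integral\<^sup>N M g = integral\<^sup>N M F"
proof -
  let ?A = "{g. simple_function M g \<and> g \<le> F}"
  have "(\<lambda>_. 0) \<in> ?A" by (auto simp: le_fun_def)
  then have "?A \<noteq> {}" by blast
  from ennreal_SUP_countable_SUP[OF this, of "integral\<^sup>S M"]
  obtain h :: "nat \<Rightarrow> ennreal" where h: "range h \<subseteq> integral\<^sup>S M ` ?A" "integral\<^sup>N M F = Sup (range h)"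
    unfolding nn_integral_def by blast
  have "\<exists>g. simple_function M g \<and> g \<le> F \<and> h n = integral\<^sup>S M g" for n
    using h(1) by blast
  then obtain g where g: "\<And>n. simple_function M (g n)" "\<And>n. g n \<le> F" "\<And>n. h n = integral\<^sup>S M (g n)"
    by metis
  show thesis
  proof
    show "(\<lambda>x. SUP n. g n x) \<in> borel_measurable M"
      using g(1) by (intro borel_measurable_SUP) (auto intro: borel_measurable_simple_function)
    show le: "(\<lambda>x. SUP n. g n x) \<le> F"
      using g(2) by (auto simp: le_fun_def intro!: SUP_least)
    have "h n \<le> (\<integral>\<^sup>+ x. (SUP n. g n x) \<partial>M)" for n
      unfolding g(3) nn_integral_eq_simple_integral[OF g(1), symmetric]
      by (intro nn_integral_mono SUP_upper) auto
    then have "integral\<^sup>N M F \<le> (\<integral>\<^sup>+ x. (SUP n. g n x) \<partial>M)"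
      unfolding h(2) by (intro SUP_least)
    moreover have "(\<integral>\<^sup>+ x. (SUP n. g n x) \<partial>M) \<le> integral\<^sup>N M F"
      using le by (intro nn_integral_mono) (auto simp: le_fun_def)
    ultimately show "(\<integral>\<^sup>+ x. (SUP n. g n x) \<partial>M) = integral\<^sup>N M F" by (rule antisym[rotated])
  qed
qed

lemma nn_integral_mixture_measurable:
  assumes sets: "sets A = sets M" "sets B = sets M"
    and mix: "\<And>X. X \<in> sets M \<Longrightarrow> emeasure M X = a * emeasure A X + b * emeasure B X"
    and "g \<in> borel_measurable M"
  shows "integral\<^sup>N M g = a * integral\<^sup>N A g + b * integral\<^sup>N B g"
  using assms(4)
proof (induction rule: borel_measurable_induct)
  case (cong f g)
  have "integral\<^sup>N N f = integral\<^sup>N N g" if "sets N = sets M" for N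
    using cong(3) sets_eq_imp_space_eq[OF that] by (intro nn_integral_cong) simp
  with cong(4) sets show ?case by simp
next
  case (set X)
  then show ?case using sets mix by simp
next
  case (mult f c)
  with sets show ?case
    by (simp add: nn_integral_cmult measurable_cong_sets[OF sets(1) refl] measurable_cong_sets[OF sets(2) refl] algebra_simps)
next
  case (add f g)
  with sets show ?case
    by (simp add: nn_integral_add measurable_cong_sets[OF sets(1) refl] measurable_cong_sets[OF sets(2) refl] algebra_simps)
next
  case (seq U)
  have "(\<Squnion>i. integral\<^sup>N M (U i)) = (\<Squnion>i. a * integral\<^sup>N A (U i) + b * integral\<^sup>N B (U i))"
    using seq by simp
  also have "\<dots> = (\<Squnion>i. a * integral\<^sup>N A (U i)) + (\<Squnion>i. b * integral\<^sup>N B (U i))"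
    using incseqD[OF \<open>incseq U\<close>] by (intro ennreal_SUP_add) (auto simp: incseq_def le_fun_def intro!: mult_left_mono nn_integral_mono)
  finally show ?case using seq sets
    by (simp add: SUP_apply[abs_def] nn_integral_monotone_convergence_SUP  measurable_cong_sets[OF sets(1) refl] measurable_cong_sets[OF sets(2) refl] SUP_mult_left_ennreal image_comp)
qed

text \<open>For a nonmeasurable \<open>F\<close> one inequality follows from a measurable minorant that is optimal for
\<open>M\<close>, the other from the maximum of two minorants optimal for \<open>A\<close> and for \<open>B\<close>.\<close>

lemma nn_integral_mixture:
  fixes F :: "'a \<Rightarrow> ennreal"
  assumes sets: "sets A = sets M" "sets B = sets M"
    and mix: "\<And>X. X \<in> sets M \<Longrightarrow> emeasure M X = a * emeasure A X + b * emeasure B X"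
  shows "integral\<^sup>N M F = a * integral\<^sup>N A F + b * integral\<^sup>N B F"
proof (rule antisym)
  have lin: "integral\<^sup>N M g = a * integral\<^sup>N A g + b * integral\<^sup>N B g"
    if "g \<in> borel_measurable M" for g
    using sets mix that by (rule nn_integral_mixture_measurable)
  note meas = measurable_cong_sets[OF sets(1) refl] measurable_cong_sets[OF sets(2) refl]
  obtain g where g: "g \<in> borel_measurable M" "g \<le> F" "integral\<^sup>N M g = integral\<^sup>N M F"
    by (rule nn_integral_measurable_minorant)
  show "integral\<^sup>N M F \<le> a * integral\<^sup>N A F + b * integral\<^sup>N B F"
    unfolding g(3)[symmetric] lin[OF g(1)] using g(2)
    by (intro add_mono mult_left_mono nn_integral_mono) (auto simp: le_fun_def)
  \<comment> \<open>A common minorant serves both summands at once.\<close>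
  obtain gA where gA: "gA \<in> borel_measurable A" "gA \<le> F" "integral\<^sup>N A gA = integral\<^sup>N A F"
    by (rule nn_integral_measurable_minorant)
  obtain gB where gB: "gB \<in> borel_measurable B" "gB \<le> F" "integral\<^sup>N B gB = integral\<^sup>N B F"
    by (rule nn_integral_measurable_minorant)
  let ?g = "\<lambda>x. max (gA x) (gB x)"
  have g': "?g \<in> borel_measurable M" using gA(1) gB(1) by (simp add: meas)
  have "a * integral\<^sup>N A F + b * integral\<^sup>N B F \<le> a * integral\<^sup>N A ?g + b * integral\<^sup>N B ?g"
    unfolding gA(3)[symmetric] gB(3)[symmetric]
    by (intro add_mono mult_left_mono nn_integral_mono) auto
  also have "\<dots> = integral\<^sup>N M ?g" by (rule lin[OF g', symmetric])
  also have "\<dots> \<le> integral\<^sup>N M F"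
    using gA(2) gB(2) by (intro nn_integral_mono) (auto simp: le_fun_def)
  finally show "a * integral\<^sup>N A F + b * integral\<^sup>N B F \<le> integral\<^sup>N M F" .
qed

section \<open>The Borel structure of the Kantorovich--Wasserstein space\<close>

text \<open>A \<open>1\<close>-Lipschitz function is determined up to a small error by its values on a fine finite net of the space,
and after normalisation at one point these values, rounded to multiples of a small number, leave finitely
many possibilities.\<close>

lemma finite_lipschitz_net:
  assumes K: "compact (UNIV :: 'a::metric_space set)" and e: "0 < (e::real)"
  shows "\<exists>F :: ('a \<Rightarrow> real) set. finite F \<and> (\<forall>\<psi>\<in>F. 1-lipschitz_on UNIV \<psi>) \<and>
    (\<forall>\<phi>. 1-lipschitz_on UNIV \<phi> \<longrightarrow> (\<exists>\<psi>\<in>F. \<exists>c. \<forall>x. \<bar>\<phi> x - \<psi> x - c\<bar> \<le> e))"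
proof -
  \<comment> \<open>Moving to the net point in each of the two functions and comparing there costs \<open>\<delta>\<close> each.\<close>
  define \<delta> where "\<delta> = e / 3"
  have \<delta>: "0 < \<delta>" using e by (simp add: \<delta>_def)
  obtain X :: "'a set" where X: "finite X" "UNIV \<subseteq> (\<Union>x\<in>X. ball x \<delta>)"
    using K \<delta> unfolding compact_eq_totally_bounded by meson
  define D where "D = diameter (UNIV :: 'a set)"
  have D: "dist x y \<le> D" for x y :: 'a
    using diameter_bounded_bound[OF compact_imp_bounded[OF K]] by (auto simp: D_def)
  define Lip where "Lip = {\<phi> :: 'a \<Rightarrow> real. 1-lipschitz_on UNIV \<phi>}"
  define code where "code \<phi> = (\<lambda>x\<in>X. \<lfloor>(\<phi> x - \<phi> undefined) / \<delta>\<rfloor>)" for \<phi> :: "'a \<Rightarrow> real"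
  have lip: "\<bar>\<phi> x - \<phi> y\<bar> \<le> dist x y" if "\<phi> \<in> Lip" for \<phi> x y
    using lipschitz_onD[of 1 UNIV \<phi> x y] that by (simp add: Lip_def dist_real_def)
  have "code ` Lip \<subseteq> (\<Pi>\<^sub>E x\<in>X. {\<lfloor>- D / \<delta>\<rfloor>..\<lfloor>D / \<delta>\<rfloor>})"
  proof (intro image_subsetI PiE_I)
    fix \<phi> x assume \<phi>: "\<phi> \<in> Lip" and x: "x \<in> X"
    have "\<bar>\<phi> x - \<phi> undefined\<bar> \<le> D" using lip[OF \<phi>, of x undefined] D[of x undefined] by linarith
    then have "- D / \<delta> \<le> (\<phi> x - \<phi> undefined) / \<delta>" "(\<phi> x - \<phi> undefined) / \<delta> \<le> D / \<delta>"
      using \<delta> by (intro divide_right_mono; linarith)+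
    then show "code \<phi> x \<in> {\<lfloor>- D / \<delta>\<rfloor>..\<lfloor>D / \<delta>\<rfloor>}"
      using x unfolding code_def by (simp only: restrict_apply' atLeastAtMost_iff floor_mono simp_thms)
  qed (simp add: code_def)
  then have fin: "finite (code ` Lip)"
    by (rule finite_subset) (intro finite_PiE X(1), simp)
  let ?F = "inv_into Lip code ` (code ` Lip)"
  show ?thesis
  proof (intro exI[of _ ?F] conjI ballI allI impI)
    show "finite ?F" using fin by (rule finite_imageI)
    show "1-lipschitz_on UNIV \<psi>" if "\<psi> \<in> ?F" for \<psi>
      using that inv_into_into[of _ code Lip] by (auto simp: Lip_def)
    fix \<phi> :: "'a \<Rightarrow> real" assume "1-lipschitz_on UNIV \<phi>"
    then have \<phi>: "\<phi> \<in> Lip" by (simp add: Lip_def)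
    show "\<exists>\<psi>\<in>?F. \<exists>c. \<forall>x. \<bar>\<phi> x - \<psi> x - c\<bar> \<le> e"
    proof (intro bexI exI allI)
      from \<phi> have c: "code \<phi> \<in> code ` Lip" by blast
      let ?\<psi> = "inv_into Lip code (code \<phi>)"
      show "?\<psi> \<in> ?F" using c by blast
      have \<psi>: "?\<psi> \<in> Lip" using inv_into_into[OF c] .
      fix x
      obtain y where y: "y \<in> X" "dist y x < \<delta>" using X(2) by (auto simp: subset_iff)
      have "code \<phi> y = code ?\<psi> y" by (simp add: f_inv_into_f[OF c])
      then have "\<lfloor>(\<phi> y - \<phi> undefined) / \<delta>\<rfloor> = \<lfloor>(?\<psi> y - ?\<psi> undefined) / \<delta>\<rfloor>" using y by (simp add: code_def)
      then have "\<bar>(\<phi> y - \<phi> undefined) / \<delta> - (?\<psi> y - ?\<psi> undefined) / \<delta>\<bar> < 1" by linarith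
      then have "\<bar>(\<phi> y - \<phi> undefined) - (?\<psi> y - ?\<psi> undefined)\<bar> < \<delta>"
        using \<delta> by (simp add: diff_divide_distrib[symmetric] abs_divide)
      moreover have "\<bar>\<phi> y - \<phi> x\<bar> < \<delta>" "\<bar>?\<psi> y - ?\<psi> x\<bar> < \<delta>"
        using lip[OF \<phi>, of y x] lip[OF \<psi>, of y x] y by linarith+
      ultimately show "\<bar>\<phi> x - ?\<psi> x - (\<phi> undefined - ?\<psi> undefined)\<bar> \<le> e"
        unfolding \<delta>_def by linarith
    qed
  qed
qed

text \<open>Constants do not contribute to the difference of two integrals, so the net modulo constants
is enough to control the distance.\<close>

lemma kant_dist_le_on_net:
  assumes K: "compact (UNIV :: 'a::metric_space set)" and e: "0 < (e::real)"
  shows "\<exists>F :: ('a \<Rightarrow> real) set. finite F \<and> (\<forall>\<psi>\<in>F. 1-lipschitz_on UNIV \<psi>) \<and>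
    (\<forall>\<mu>\<in>prob_measures. \<forall>\<nu>\<in>prob_measures.
      (\<forall>\<psi>\<in>F. (LINT x|\<mu>. \<psi> x) - (LINT x|\<nu>. \<psi> x) \<le> e) \<longrightarrow> kant_dist \<mu> \<nu> \<le> 3 * e)"
proof -
  obtain F :: "('a \<Rightarrow> real) set" where F: "finite F" "\<And>\<psi>. \<psi> \<in> F \<Longrightarrow> 1-lipschitz_on UNIV \<psi>"
    "\<And>\<phi>. 1-lipschitz_on UNIV \<phi> \<Longrightarrow> \<exists>\<psi>\<in>F. \<exists>c. \<forall>x. \<bar>\<phi> x - \<psi> x - c\<bar> \<le> e"
    using finite_lipschitz_net[OF K e] by metis
  show ?thesis
  proof (intro exI[of _ F] conjI ballI impI F(1,2))
    fix \<mu> \<nu> :: "'a measure"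
    assume M: "\<mu> \<in> prob_measures" "\<nu> \<in> prob_measures"
      and le: "\<forall>\<psi>\<in>F. (LINT x|\<mu>. \<psi> x) - (LINT x|\<nu>. \<psi> x) \<le> e"
    show "kant_dist \<mu> \<nu> \<le> 3 * e"
    proof (rule kant_dist_leI[OF M])
      fix \<phi> :: "'a \<Rightarrow> real" assume \<phi>: "1-lipschitz_on UNIV \<phi>"
      obtain \<psi> c where \<psi>: "\<psi> \<in> F" "\<And>x. \<bar>\<phi> x - \<psi> x - c\<bar> \<le> e" using F(3)[OF \<phi>] by blast
      have *: "\<bar>(LINT x|\<rho>. \<phi> x) - (LINT x|\<rho>. \<psi> x) - c\<bar> \<le> e" if \<rho>: "\<rho> \<in> prob_measures" for \<rho>
      proof -
        interpret prob_space \<rho> using \<rho> by (simp add: prob_measures_def)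
        note i = lipschitz_integrable[OF K \<phi> \<rho>] lipschitz_integrable[OF K F(2)[OF \<psi>(1)] \<rho>]
        have eq: "(LINT x|\<rho>. \<phi> x) - (LINT x|\<rho>. \<psi> x) - c = (LINT x|\<rho>. \<phi> x - \<psi> x - c)"
          using i by (simp add: prob_space)
        have i': "integrable \<rho> (\<lambda>x. \<phi> x - \<psi> x - c)" using i by simp
        have "\<phi> x - \<psi> x - c \<le> e" "- e \<le> \<phi> x - \<psi> x - c" for x using \<psi>(2)[of x] by linarith+
        then have "(LINT x|\<rho>. \<phi> x - \<psi> x - c) \<le> e" "- e \<le> (LINT x|\<rho>. \<phi> x - \<psi> x - c)"
          by (auto intro!: integral_le_const[OF i'] integral_ge_const[OF i'])
        then show ?thesis unfolding eq by linarith
      qed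
      show "(LINT x|\<mu>. \<phi> x) - (LINT x|\<nu>. \<phi> x) \<le> 3 * e"
        using *[OF M(1)] *[OF M(2)] bspec[OF le \<psi>(1)] by linarith
    qed
  qed
qed

lemma space_prob_borel: "space prob_borel = prob_measures"
  by (simp add: prob_borel_def space_measure_of_conv)

lemma sets_prob_borel:
  assumes K: "compact (UNIV :: 'a::metric_space set)"
  shows "sets prob_borel = sigma_sets prob_measures {U :: 'a measure set. openin prob_topology U}"
proof -
  interpret Metric_space "prob_measures :: 'a measure set" kant_dist
    by (rule Metric_space_prob_measures[OF K])
  show ?thesis unfolding prob_borel_def
    using openin_subset by (subst sets_measure_of) (fastforce simp: topspace_mtopology)+
qed

lemma measurable_integral_prob_borel:
  assumes K: "compact (UNIV :: 'a::metric_space set)" and \<psi>: "1-lipschitz_on UNIV (\<psi> :: 'a \<Rightarrow> real)"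
  shows "(\<lambda>\<nu>. LINT x|\<nu>. \<psi> x) \<in> borel_measurable prob_borel"
  unfolding borel_measurable_iff_less
proof
  fix a
  interpret Metric_space "prob_measures :: 'a measure set" kant_dist
    by (rule Metric_space_prob_measures[OF K])
  let ?U = "{\<nu> \<in> prob_measures. (LINT x|\<nu>. \<psi> x) < a}"
  have "openin mtopology ?U" unfolding openin_mtopology
  proof (intro conjI allI impI)
    fix \<nu> assume \<nu>: "\<nu> \<in> ?U"
    have "mball \<nu> (a - (LINT x|\<nu>. \<psi> x)) \<subseteq> ?U"
    proof
      fix \<mu> assume "\<mu> \<in> mball \<nu> (a - (LINT x|\<nu>. \<psi> x))"
      then show "\<mu> \<in> ?U" using kant_dist_ge[OF K \<psi>, of \<mu> \<nu>] by (auto simp: commute)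
    qed
    then show "\<exists>r>0. mball \<nu> r \<subseteq> ?U" using \<nu> by (intro exI[of _ "a - (LINT x|\<nu>. \<psi> x)"]) auto
  qed auto
  then show "{\<nu> \<in> space prob_borel. (LINT x|\<nu>. \<psi> x) < a} \<in> sets prob_borel"
    by (simp add: sets_prob_borel[OF K] space_prob_borel)
qed

text \<open>The cells fix the integrals of the members of a finite net up to rounding. The lemma is stated
for any \<open>\<sigma>\<close>-algebra that makes these integrals measurable, since it serves both to recover the
Borel sets from the integrals and to decompose the Borel sets themselves.\<close>

lemma countable_fine_cells:
  fixes N :: "'a::metric_space measure measure"
  assumes K: "compact (UNIV :: 'a set)" and N: "space N = prob_measures"
    and int: "\<And>\<psi> :: 'a \<Rightarrow> real. 1-lipschitz_on UNIV \<psi> \<Longrightarrow> (\<lambda>\<nu>. LINT x|\<nu>. \<psi> x) \<in> borel_measurable N"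
  obtains \<C> where "countable \<C>" "\<C> \<subseteq> sets N"
    "\<And>\<nu> e. \<nu> \<in> prob_measures \<Longrightarrow> 0 < e \<Longrightarrow>
      \<exists>C\<in>\<C>. \<nu> \<in> C \<and> C \<subseteq> Metric_space.mball prob_measures kant_dist \<nu> e"
proof -
  interpret Metric_space "prob_measures :: 'a measure set" kant_dist
    by (rule Metric_space_prob_measures[OF K])
  have "\<exists>F :: ('a \<Rightarrow> real) set. finite F \<and> (\<forall>\<psi>\<in>F. 1-lipschitz_on UNIV \<psi>) \<and>
    (\<forall>\<mu>\<in>prob_measures. \<forall>\<nu>\<in>prob_measures. (\<forall>\<psi>\<in>F. (LINT x|\<mu>. \<psi> x) - (LINT x|\<nu>. \<psi> x) \<le> 1 / real (Suc n))
      \<longrightarrow> kant_dist \<mu> \<nu> \<le> 3 * (1 / real (Suc n)))" for n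
    by (rule kant_dist_le_on_net[OF K]) simp
  then obtain F :: "nat \<Rightarrow> ('a \<Rightarrow> real) set" where F: "\<And>n. finite (F n)" "\<And>n \<psi>. \<psi> \<in> F n \<Longrightarrow> 1-lipschitz_on UNIV \<psi>"
    "\<And>n \<mu> \<nu>. \<mu> \<in> prob_measures \<Longrightarrow> \<nu> \<in> prob_measures \<Longrightarrow>
      (\<And>\<psi>. \<psi> \<in> F n \<Longrightarrow> (LINT x|\<mu>. \<psi> x) - (LINT x|\<nu>. \<psi> x) \<le> 1 / real (Suc n)) \<Longrightarrow> kant_dist \<mu> \<nu> \<le> 3 * (1 / real (Suc n))"
    by metis
  define C where "C n q = {\<nu> \<in> space N. \<forall>\<psi>\<in>F n. \<lfloor>real (Suc n) * (LINT x|\<nu>. \<psi> x)\<rfloor> = q \<psi>}"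
    for n and q :: "('a \<Rightarrow> real) \<Rightarrow> int"
  show thesis
  proof
    let ?\<C> = "\<Union>n. C n ` (\<Pi>\<^sub>E \<psi>\<in>F n. UNIV)"
    show "countable ?\<C>"
      by (intro countable_UN countable_image countable_PiE F(1)) auto
    have "C n q \<in> sets N" for n q
    proof -
      have "(\<lambda>\<nu>. \<lfloor>real (Suc n) * (LINT x|\<nu>. \<psi> x)\<rfloor>) \<in> measurable N (count_space UNIV)" if "\<psi> \<in> F n" for \<psi>
        using int[OF F(2)[OF that]] by measurable
      then have "Measurable.pred N (\<lambda>\<nu>. \<lfloor>real (Suc n) * (LINT x|\<nu>. \<psi> x)\<rfloor> = q \<psi>)" if "\<psi> \<in> F n" for \<psi>
        using that by measurable
      then show ?thesis unfolding C_def
        by (intro sets.sets_Collect_finite_All F(1)) (simp add: pred_def)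
    qed
    then show "?\<C> \<subseteq> sets N" by auto
    fix \<nu> :: "'a measure" and e :: real
    assume \<nu>: "\<nu> \<in> prob_measures" and e: "0 < e"
    obtain n where n: "inverse (real (Suc n)) < e / 3" using reals_Archimedean[of "e / 3"] e by auto
    define q where "q = (\<lambda>\<psi>\<in>F n. \<lfloor>real (Suc n) * (LINT x|\<nu>. \<psi> x)\<rfloor>)"
    have "C n q \<subseteq> mball \<nu> e"
    proof
      fix \<mu> assume \<mu>: "\<mu> \<in> C n q"
      then have M: "\<mu> \<in> prob_measures" by (simp add: C_def N)
      have "kant_dist \<nu> \<mu> \<le> 3 * (1 / real (Suc n))"
      proof (rule F(3)[OF \<nu> M])
        fix \<psi> assume \<psi>: "\<psi> \<in> F n"
        then have "\<lfloor>real (Suc n) * (LINT x|\<mu>. \<psi> x)\<rfloor> = \<lfloor>real (Suc n) * (LINT x|\<nu>. \<psi> x)\<rfloor>"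
          using \<mu> by (simp add: C_def q_def)
        then have "real (Suc n) * (LINT x|\<nu>. \<psi> x) - real (Suc n) * (LINT x|\<mu>. \<psi> x) \<le> 1" by linarith
        then have "((LINT x|\<nu>. \<psi> x) - (LINT x|\<mu>. \<psi> x)) * real (Suc n) \<le> 1"
          unfolding left_diff_distrib by (simp only: mult.commute)
        then show "(LINT x|\<nu>. \<psi> x) - (LINT x|\<mu>. \<psi> x) \<le> 1 / real (Suc n)"
          by (simp only: pos_le_divide_eq of_nat_0_less_iff zero_less_Suc)
      qed
      then show "\<mu> \<in> mball \<nu> e" using n \<nu> M by (simp add: inverse_eq_divide)
    qed
    moreover have "\<nu> \<in> C n q" using \<nu> by (simp add: C_def q_def N)
    moreover have "q \<in> (\<Pi>\<^sub>E \<psi>\<in>F n. UNIV)" by (simp add: q_def)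
    then have "C n q \<in> ?\<C>" by blast
    ultimately show "\<exists>C\<in>?\<C>. \<nu> \<in> C \<and> C \<subseteq> mball \<nu> e" by blast
  qed
qed

text \<open>A map into the Kantorovich--Wasserstein space is Borel as soon as it is measurable for the
\<open>\<sigma>\<close>-algebra generated by the integrals of \<open>1\<close>-Lipschitz functions, because every open set is a
countable union of cells of that \<open>\<sigma>\<close>-algebra.\<close>

lemma measurable_prob_borelI:
  fixes g :: "'b \<Rightarrow> 'a::metric_space measure"
  assumes K: "compact (UNIV :: 'a set)" and g: "g \<in> space M \<rightarrow> prob_measures"
    and int: "\<And>\<psi> :: 'a \<Rightarrow> real. 1-lipschitz_on UNIV \<psi> \<Longrightarrow> (\<lambda>x. LINT y|g x. \<psi> y) \<in> borel_measurable M"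
  shows "g \<in> measurable M prob_borel"
proof -
  interpret Metric_space "prob_measures :: 'a measure set" kant_dist
    by (rule Metric_space_prob_measures[OF K])
  define G where "G = {{\<nu> \<in> prob_measures. (LINT x|\<nu>. \<psi> x) < a} |\<psi> a. 1-lipschitz_on UNIV (\<psi> :: 'a \<Rightarrow> real)}"
  have G: "G \<subseteq> Pow prob_measures" by (auto simp: G_def)
  define N where "N = sigma prob_measures G"
  have N: "space N = prob_measures" "sets N = sigma_sets prob_measures G"
    using G by (simp_all add: N_def)
  have "(\<lambda>\<nu>. LINT x|\<nu>. \<psi> x) \<in> borel_measurable N" if "1-lipschitz_on UNIV \<psi>" for \<psi> :: "'a \<Rightarrow> real"
    unfolding borel_measurable_iff_less using that by (auto simp: N G_def)
  from countable_fine_cells[OF K N(1) this] obtain \<C> where \<C>: "countable \<C>" "\<C> \<subseteq> sets N"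
    "\<And>\<nu> e. \<nu> \<in> prob_measures \<Longrightarrow> 0 < e \<Longrightarrow> \<exists>C\<in>\<C>. \<nu> \<in> C \<and> C \<subseteq> mball \<nu> e"
    by blast
  have gN: "g \<in> measurable M N" unfolding N_def
  proof (rule measurable_measure_of[OF G g])
    fix A assume "A \<in> G"
    then obtain \<psi> a where \<psi>: "1-lipschitz_on UNIV (\<psi> :: 'a \<Rightarrow> real)" "A = {\<nu> \<in> prob_measures. (LINT x|\<nu>. \<psi> x) < a}"
      by (auto simp: G_def)
    have "g -` A \<inter> space M = {x \<in> space M. (LINT y|g x. \<psi> y) < a}" using g \<psi> by auto
    then show "g -` A \<inter> space M \<in> sets M" using int[OF \<psi>(1)] by simp
  qed
  show ?thesis unfolding prob_borel_def
  proof (rule measurable_measure_of[OF _ g])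
    show "{U :: 'a measure set. openin mtopology U} \<subseteq> Pow prob_measures"
      using openin_subset topspace_mtopology by fastforce
    fix U assume "U \<in> {U :: 'a measure set. openin mtopology U}"
    then have U: "openin mtopology U" by simp
    have "U = \<Union>{C\<in>\<C>. C \<subseteq> U}"
    proof (intro equalityI subsetI)
      fix \<nu> assume \<nu>: "\<nu> \<in> U"
      then obtain r where "0 < r" "mball \<nu> r \<subseteq> U" using U unfolding openin_mtopology by blast
      moreover have "\<nu> \<in> prob_measures" using U \<nu> openin_subset topspace_mtopology by fastforce
      ultimately show "\<nu> \<in> \<Union>{C\<in>\<C>. C \<subseteq> U}" using \<C>(3)[of \<nu> r] by blast
    qed auto
    also have "\<dots> \<in> sets N"
      by (rule sets.countable_Union) (use \<C> in \<open>auto intro: countable_subset[of _ \<C>]\<close>)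
    finally show "g -` U \<inter> space M \<in> sets M" using gN by (rule measurable_sets[rotated])
  qed
qed

text \<open>A strict sublevel set of the distance is a countable union of products of two cells. This
is the separability that the product \<open>\<sigma>\<close>-algebra requires.\<close>

lemma measurable_kant_dist:
  assumes K: "compact (UNIV :: 'a::metric_space set)"
  shows "case_prod kant_dist \<in> borel_measurable (prob_borel \<Otimes>\<^sub>M (prob_borel :: 'a measure measure))"
  unfolding borel_measurable_iff_less
proof
  fix a
  interpret Metric_space "prob_measures :: 'a measure set" kant_dist
    by (rule Metric_space_prob_measures[OF K])
  obtain \<C> where \<C>: "countable \<C>" "\<C> \<subseteq> sets (prob_borel :: 'a measure measure)"
    "\<And>\<nu> e. \<nu> \<in> prob_measures \<Longrightarrow> 0 < e \<Longrightarrow> \<exists>C\<in>\<C>. \<nu> \<in> C \<and> C \<subseteq> mball \<nu> e"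
    using countable_fine_cells[OF K space_prob_borel measurable_integral_prob_borel[OF K]] by blast
  let ?E = "{z \<in> space (prob_borel \<Otimes>\<^sub>M (prob_borel :: 'a measure measure)). case_prod kant_dist z < a}"
  let ?\<D> = "{p \<in> \<C> \<times> \<C>. fst p \<times> snd p \<subseteq> ?E}"
  have "?E = (\<Union>p\<in>?\<D>. fst p \<times> snd p)"
  proof (intro equalityI subsetI)
    fix z assume z: "z \<in> ?E"
    then obtain \<mu> \<nu> where [simp]: "z = (\<mu>, \<nu>)" and M: "\<mu> \<in> prob_measures" "\<nu> \<in> prob_measures" and less: "kant_dist \<mu> \<nu> < a"
      by (cases z) (auto simp: space_pair_measure space_prob_borel)
    define e where "e = (a - kant_dist \<mu> \<nu>) / 2"
    have e: "0 < e" using less by (simp add: e_def)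
    obtain C D where C: "C \<in> \<C>" "\<mu> \<in> C" "C \<subseteq> mball \<mu> e" and D: "D \<in> \<C>" "\<nu> \<in> D" "D \<subseteq> mball \<nu> e"
      using \<C>(3)[OF M(1) e] \<C>(3)[OF M(2) e] by blast
    have "C \<times> D \<subseteq> ?E"
    proof
      fix w assume "w \<in> C \<times> D"
      then obtain \<mu>' \<nu>' where [simp]: "w = (\<mu>', \<nu>')" and w: "\<mu>' \<in> mball \<mu> e" "\<nu>' \<in> mball \<nu> e" using C D by blast
      then show "w \<in> ?E"
        using triangle[of \<mu>' \<mu> \<nu>'] triangle[of \<mu> \<nu> \<nu>'] M commute[of \<mu> \<mu>'] less
        by (auto simp: space_pair_measure space_prob_borel e_def field_simps)
    qed
    then show "z \<in> (\<Union>p\<in>?\<D>. fst p \<times> snd p)" using C D by (intro UN_I[of "(C, D)"]) auto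
  qed auto
  also have "\<dots> \<in> sets (prob_borel \<Otimes>\<^sub>M prob_borel)"
    by (rule sets.countable_UN'') (use \<C>(1,2) in \<open>auto intro!: countable_subset[of ?\<D> "\<C> \<times> \<C>"] pair_measureI\<close>)
  finally show "?E \<in> sets (prob_borel \<Otimes>\<^sub>M prob_borel)" .
qed

section \<open>Completeness of the Kantorovich--Wasserstein space\<close>

text \<open>The Lipschitz constant is left open so that these functions form a vector lattice.\<close>

definition lipschitz :: "('a::metric_space \<Rightarrow> real) \<Rightarrow> bool" where
  "lipschitz \<phi> \<longleftrightarrow> (\<exists>L. L-lipschitz_on UNIV \<phi>)"

lemma lipschitzI: "(\<And>x y. \<bar>\<phi> x - \<phi> y\<bar> \<le> L * dist x y) \<Longrightarrow> 0 \<le> L \<Longrightarrow> lipschitz \<phi>"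
  unfolding lipschitz_def by (auto intro!: exI[of _ L] lipschitz_onI simp: dist_real_def)

lemma lipschitz_const: "lipschitz (\<lambda>_. c)"
  unfolding lipschitz_def using lipschitz_on_constant by blast

lemma lipschitz_add: "lipschitz \<phi> \<Longrightarrow> lipschitz \<psi> \<Longrightarrow> lipschitz (\<lambda>x. \<phi> x + \<psi> x)"
  unfolding lipschitz_def by (blast intro: lipschitz_on_add)

lemma lipschitz_cmult: "lipschitz \<phi> \<Longrightarrow> lipschitz (\<lambda>x. c * \<phi> x)"
  unfolding lipschitz_def by (blast intro: lipschitz_on_cmult_real)

lemma lipschitz_diff: "lipschitz \<phi> \<Longrightarrow> lipschitz \<psi> \<Longrightarrow> lipschitz (\<lambda>x. \<phi> x - \<psi> x)"
  unfolding lipschitz_def by (blast intro: lipschitz_on_diff)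

lemma lipschitz_sum: "(\<And>i. i \<in> I \<Longrightarrow> lipschitz (\<phi> i)) \<Longrightarrow> lipschitz (\<lambda>x. \<Sum>i\<in>I. \<phi> i x)"
  by (induction I rule: infinite_finite_induct) (auto intro: lipschitz_const lipschitz_add)

lemma lipschitz_max:
  fixes \<phi> \<psi> :: "'a::metric_space \<Rightarrow> real"
  assumes "lipschitz \<phi>" "lipschitz \<psi>" shows "lipschitz (\<lambda>x. max (\<phi> x) (\<psi> x))"
proof -
  obtain L L' where L: "L-lipschitz_on UNIV \<phi>" "L'-lipschitz_on UNIV \<psi>"
    using assms by (auto simp: lipschitz_def)
  show ?thesis
  proof (rule lipschitzI)
    fix x y :: 'a
    have "L * dist x y \<le> max L L' * dist x y" "L' * dist x y \<le> max L L' * dist x y"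
      by (intro mult_right_mono; simp)+
    then show "\<bar>max (\<phi> x) (\<psi> x) - max (\<phi> y) (\<psi> y)\<bar> \<le> max L L' * dist x y"
      using lipschitz_onD[OF L(1), of x y] lipschitz_onD[OF L(2), of x y] by (auto simp: dist_real_def)
  qed (use lipschitz_on_nonneg[OF L(1)] in simp)
qed

lemma lipschitz_min: assumes "lipschitz \<phi>" "lipschitz \<psi>" shows "lipschitz (\<lambda>x. min (\<phi> x) (\<psi> x))"
  using lipschitz_cmult[OF lipschitz_max[OF lipschitz_cmult[OF assms(1), of "-1"] lipschitz_cmult[OF assms(2), of "-1"]], of "-1"]
  by (simp add: minus_max_eq_min)

lemma lipschitz_infdist: "lipschitz (\<lambda>x. infdist x A)"
  by (rule lipschitzI[where L = 1]) (simp_all add: infdist_triangle_abs)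

lemmas lipschitz_closure = lipschitz_const lipschitz_add lipschitz_cmult lipschitz_diff lipschitz_sum
  lipschitz_max lipschitz_min lipschitz_infdist

lemma lipschitz_continuous: "lipschitz \<phi> \<Longrightarrow> continuous_on UNIV \<phi>"
  unfolding lipschitz_def by (blast intro: lipschitz_on_continuous_on)

lemma lipschitz_positive_on_open:
  assumes "open (U :: 'a::metric_space set)"
  obtains a where "lipschitz a" "\<And>x. 0 \<le> a x" "\<And>x. x \<in> U \<longleftrightarrow> 0 < a x"
proof (cases "U = UNIV")
  case True
  then show ?thesis by (intro that[of "\<lambda>_. 1"]) (auto simp: lipschitz_const)
next
  case False
  then have "-U \<noteq> {}" "closed (-U)" using assms by auto
  then have "x \<in> U \<longleftrightarrow> 0 < infdist x (-U)" for x
    using in_closed_iff_infdist_zero[of "-U" x] infdist_nonneg[of x "-U"] by auto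
  then show ?thesis by (intro that[of "\<lambda>x. infdist x (-U)"]) (auto simp: lipschitz_infdist infdist_nonneg)
qed

text \<open>A normalised positive linear functional on the Lipschitz functions of a compact metric space. The
Riesz representation theorem for it is proved through the outer measure that the functional
induces. Lipschitz functions, rather than all continuous ones, are the natural domain here: they
form a vector lattice that contains the distance functions to sets, and the Kantorovich--Wasserstein
distance gives convergence of exactly their integrals.\<close>

locale positive_functional =
  fixes \<Lambda> :: "('a::metric_space \<Rightarrow> real) \<Rightarrow> real"
  assumes K: "compact (UNIV :: 'a set)"
    and add: "\<And>\<phi> \<psi>. lipschitz \<phi> \<Longrightarrow> lipschitz \<psi> \<Longrightarrow> \<Lambda> (\<lambda>x. \<phi> x + \<psi> x) = \<Lambda> \<phi> + \<Lambda> \<psi>"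
    and cmult: "\<And>c \<phi>. lipschitz \<phi> \<Longrightarrow> \<Lambda> (\<lambda>x. c * \<phi> x) = c * \<Lambda> \<phi>"
    and nonneg: "\<And>\<phi>. lipschitz \<phi> \<Longrightarrow> (\<And>x. 0 \<le> \<phi> x) \<Longrightarrow> 0 \<le> \<Lambda> \<phi>"
    and one: "\<Lambda> (\<lambda>_. 1) = 1"
begin

lemma diff: "lipschitz \<phi> \<Longrightarrow> lipschitz \<psi> \<Longrightarrow> \<Lambda> (\<lambda>x. \<phi> x - \<psi> x) = \<Lambda> \<phi> - \<Lambda> \<psi>"
  using add[of \<phi> "\<lambda>x. - 1 * \<psi> x"] cmult[of \<psi> "-1"] lipschitz_cmult[of \<psi> "-1"] by simp

lemma const: "\<Lambda> (\<lambda>_. c) = c"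
  using cmult[OF lipschitz_const, of c 1] one by simp

lemma mono: "lipschitz \<phi> \<Longrightarrow> lipschitz \<psi> \<Longrightarrow> (\<And>x. \<phi> x \<le> \<psi> x) \<Longrightarrow> \<Lambda> \<phi> \<le> \<Lambda> \<psi>"
  using nonneg[of "\<lambda>x. \<psi> x - \<phi> x"] diff[of \<psi> \<phi>] lipschitz_diff[of \<psi> \<phi>] by simp

lemma sum: "finite I \<Longrightarrow> (\<And>i. i \<in> I \<Longrightarrow> lipschitz (\<phi> i)) \<Longrightarrow> \<Lambda> (\<lambda>x. \<Sum>i\<in>I. \<phi> i x) = (\<Sum>i\<in>I. \<Lambda> (\<phi> i))"
  by (induction I rule: finite_induct) (simp_all add: const add lipschitz_sum)

definition below :: "'a set \<Rightarrow> ('a \<Rightarrow> real) set" where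
  "below U = {\<phi>. lipschitz \<phi> \<and> (\<forall>x. 0 \<le> \<phi> x \<and> \<phi> x \<le> indicator U x)}"

lemma belowI: "lipschitz \<phi> \<Longrightarrow> (\<And>x. 0 \<le> \<phi> x) \<Longrightarrow> (\<And>x. \<phi> x \<le> 1) \<Longrightarrow> (\<And>x. x \<notin> U \<Longrightarrow> \<phi> x = 0) \<Longrightarrow> \<phi> \<in> below U"
  by (auto simp: below_def split: split_indicator)

lemma belowD: assumes "\<phi> \<in> below U" shows "lipschitz \<phi>" "0 \<le> \<phi> x" "\<phi> x \<le> 1" "x \<notin> U \<Longrightarrow> \<phi> x = 0"
proof -
  have *: "0 \<le> \<phi> x \<and> \<phi> x \<le> indicator U x" using assms by (simp add: below_def)
  then show "0 \<le> \<phi> x" "\<phi> x \<le> 1" "x \<notin> U \<Longrightarrow> \<phi> x = 0"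
    using indicator_le_1[of U x] by (auto intro: order_trans)
  show "lipschitz \<phi>" using assms by (simp add: below_def)
qed

lemma zero_below: "(\<lambda>_. 0) \<in> below U"
  by (intro belowI lipschitz_const) auto

text \<open>For open \<open>U\<close> this is the mass that a measure representing the functional must give to \<open>U\<close>.\<close>

definition content :: "'a set \<Rightarrow> ennreal" where
  "content U = (SUP \<phi>\<in>below U. ennreal (\<Lambda> \<phi>))"

definition outer_content :: "'a set \<Rightarrow> ennreal" where
  "outer_content A = (INF U\<in>{U. open U \<and> A \<subseteq> U}. content U)"

lemma content_ge: "\<phi> \<in> below U \<Longrightarrow> ennreal (\<Lambda> \<phi>) \<le> content U"
  unfolding content_def by (rule SUP_upper)

lemma content_mono: "U \<subseteq> V \<Longrightarrow> content U \<le> content V"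
  unfolding content_def
  by (intro SUP_subset_mono order_refl) (auto intro!: belowI dest: belowD)

lemma content_le_1: "content U \<le> 1"
  unfolding content_def
proof (rule SUP_least)
  fix \<phi> assume "\<phi> \<in> below U"
  then have "\<Lambda> \<phi> \<le> \<Lambda> (\<lambda>_. 1)" by (intro mono lipschitz_const) (auto dest: belowD)
  then show "ennreal (\<Lambda> \<phi>) \<le> 1" by (simp add: one)
qed

lemma content_UNIV: "content UNIV = 1"
proof (rule antisym[OF content_le_1])
  have "(\<lambda>_. 1) \<in> below UNIV" by (intro belowI lipschitz_const) auto
  from content_ge[OF this] show "1 \<le> content UNIV" by (simp add: one)
qed

lemma content_empty: "content {} = 0"
proof -
  have "\<phi> = (\<lambda>_. 0)" if "\<phi> \<in> below {}" for \<phi> using belowD(4)[OF that] by auto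
  then show ?thesis unfolding content_def using const[of 0] by (metis SUP_least bot.extremum_uniqueI bot_ennreal ennreal_0 order_refl)
qed

lemma outer_content_open: "open U \<Longrightarrow> outer_content U = content U"
  unfolding outer_content_def by (intro antisym INF_lower INF_greatest content_mono) auto

lemma outer_content_le: "open U \<Longrightarrow> A \<subseteq> U \<Longrightarrow> outer_content A \<le> content U"
  unfolding outer_content_def by (rule INF_lower) auto

lemma outer_content_mono: "A \<subseteq> B \<Longrightarrow> outer_content A \<le> outer_content B"
  unfolding outer_content_def by (intro INF_superset_mono order_refl) auto

text \<open>Up to a uniform error \<open>e\<close>, a function \<open>\<phi>\<close> below \<open>U\<close> is carried by the compact set
\<open>{x. e \<le> \<phi> x}\<close>, which finitely many of the \<open>V i\<close> cover. Truncating at the partial sums of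
functions positive exactly on the \<open>V i\<close> splits \<open>max 0 (\<phi> - e)\<close> into Lipschitz pieces below
the \<open>V i\<close>, in place of a partition of unity.\<close>

lemma content_subadditive:
  assumes U: "open U" and V: "\<And>i::nat. open (V i)" and sub: "U \<subseteq> (\<Union>i. V i)"
  shows "content U \<le> (\<Sum>i. content (V i))"
  unfolding content_def[of U]
proof (rule SUP_least, rule ennreal_le_epsilon)
  fix \<phi> and e :: real
  assume \<phi>: "\<phi> \<in> below U" and e: "0 < e"
  have "\<exists>a. lipschitz a \<and> (\<forall>x. 0 \<le> a x) \<and> (\<forall>x. x \<in> V i \<longleftrightarrow> 0 < a x)" for i
    using lipschitz_positive_on_open[OF V[of i]] by metis
  then obtain a where a: "\<And>i. lipschitz (a i)" "\<And>i x. 0 \<le> a i x" "\<And>i x. x \<in> V i \<longleftrightarrow> 0 < a i x" by metis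
  define S where "S n x = (\<Sum>i<n. a i x)" for n x
  have S: "lipschitz (S n)" for n unfolding S_def by (intro lipschitz_sum a)
  \<comment> \<open>These open sets increase with \<open>n\<close>, so compactness yields both the finite subfamily of
    cover members and the factor in front of their sum in one step.\<close>
  define G where "G n = {x. 1 < real n * S n x}" for n
  have openG: "open (G n)" for n unfolding G_def
    by (intro open_Collect_less continuous_intros lipschitz_continuous S)
  have Gmono: "G m \<subseteq> G n" if "m \<le> n" for m n
  proof -
    have "real m * S m x \<le> real n * S n x" for x unfolding S_def
      using that a(2) by (intro mult_mono sum_mono2 sum_nonneg) auto
    then show ?thesis by (auto simp: G_def intro: less_le_trans)
  qed
  define C where "C = {x. e \<le> \<phi> x}"
  have "closed C" unfolding C_def
    by (intro closed_Collect_le continuous_intros lipschitz_continuous belowD[OF \<phi>])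
  then have "compact C" using compact_Int_closed[OF K] by simp
  moreover have "C \<subseteq> (\<Union>n. G n)"
  proof
    fix x assume "x \<in> C"
    then have "x \<in> U" using e belowD(4)[OF \<phi>, of x] by (auto simp: C_def)
    then obtain i where i: "0 < a i x" using sub a(3) by blast
    obtain k :: nat where k: "1 / a i x < real k" using reals_Archimedean2 by blast
    define n where "n = max k (Suc i)"
    have "1 < real k * a i x" using k i by (simp add: field_simps)
    also have "\<dots> \<le> real n * S n x" unfolding S_def n_def using a(2)
      by (intro mult_mono member_le_sum) auto
    finally show "x \<in> (\<Union>n. G n)" by (auto simp: G_def)
  qed
  ultimately obtain D where D: "finite D" "C \<subseteq> (\<Union>n\<in>D. G n)"
    using openG by (metis compactE_image UNIV_I)
  define N where "N = Max (insert 0 D)"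
  have CN: "C \<subseteq> G N"
  proof
    fix x assume "x \<in> C"
    then obtain n where "n \<in> D" "x \<in> G n" using D by auto
    moreover have "n \<le> N" unfolding N_def using \<open>n \<in> D\<close> D(1) by (intro Max_ge) auto
    ultimately show "x \<in> G N" using Gmono by blast
  qed
  \<comment> \<open>\<open>T\<close> interpolates from \<open>0\<close> to \<open>max 0 (\<phi> - e)\<close>; its \<open>j\<close>-th increment vanishes off \<open>V j\<close>.\<close>
  define T where "T j x = min (max 0 (\<phi> x - e)) (real N * S j x)" for j x
  have T: "lipschitz (T j)" for j unfolding T_def
    by (intro lipschitz_closure S belowD[OF \<phi>])
  have T_le: "ennreal (\<Lambda> (T j)) \<le> (\<Sum>i<j. content (V i))" for j
  proof (induction j)
    case 0
    have "T 0 = (\<lambda>_. 0)" by (auto simp: T_def S_def)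
    then show ?case using const[of 0] by simp
  next
    case (Suc j)
    have S_Suc: "S (Suc j) x = S j x + a j x" for x by (simp add: S_def)
    have S0: "0 \<le> S j x" for x by (simp add: S_def sum_nonneg a)
    have le: "T j x \<le> T (Suc j) x" for x
      unfolding T_def S_Suc using a(2)[of j x] by (intro min.mono mult_left_mono) auto
    have "(\<lambda>x. T (Suc j) x - T j x) \<in> below (V j)"
    proof (rule belowI)
      fix x
      show "0 \<le> T (Suc j) x - T j x" using le by simp
      have "T (Suc j) x \<le> 1" using belowD(3)[OF \<phi>, of x] e unfolding T_def by linarith
      moreover have "0 \<le> T j x" using S0 by (simp add: T_def)
      ultimately show "T (Suc j) x - T j x \<le> 1" by simp
      show "T (Suc j) x - T j x = 0" if "x \<notin> V j"
        using that a(3)[of x j] a(2)[of j x] by (auto simp: T_def S_Suc)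
    qed (intro lipschitz_diff T)
    from content_ge[OF this] have "ennreal (\<Lambda> (T (Suc j)) - \<Lambda> (T j)) \<le> content (V j)" by (simp add: diff T)
    moreover have "0 \<le> \<Lambda> (T j)" using S0 by (intro nonneg T) (simp add: T_def)
    moreover have "\<Lambda> (T j) \<le> \<Lambda> (T (Suc j))" using le by (intro mono T)
    ultimately have "ennreal (\<Lambda> (T (Suc j))) \<le> ennreal (\<Lambda> (T j)) + content (V j)"
      using ennreal_plus[of "\<Lambda> (T j)" "\<Lambda> (T (Suc j)) - \<Lambda> (T j)"] by (simp add: add_left_mono)
    also have "\<dots> \<le> (\<Sum>i<Suc j. content (V i))" using Suc by (simp add: add_right_mono)
    finally show ?case .
  qed
  have "\<phi> x \<le> T N x + e" for x
  proof (cases "x \<in> C")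
    case True
    then have "1 < real N * S N x" using CN by (auto simp: G_def)
    then show ?thesis using belowD(3)[OF \<phi>, of x] e unfolding T_def by linarith
  next
    case False
    have "0 \<le> real N * S N x" by (simp add: S_def sum_nonneg a)
    then show ?thesis using False unfolding T_def C_def by auto
  qed
  then have "\<Lambda> \<phi> \<le> \<Lambda> (\<lambda>x. T N x + e)"
    by (intro mono lipschitz_add T lipschitz_const belowD[OF \<phi>])
  then have "\<Lambda> \<phi> \<le> \<Lambda> (T N) + e" by (simp add: add T lipschitz_const const)
  moreover have "0 \<le> \<Lambda> (T N)" by (intro nonneg T) (simp add: T_def S_def sum_nonneg a)
  ultimately have "ennreal (\<Lambda> \<phi>) \<le> ennreal (\<Lambda> (T N)) + ennreal e"
    using e by (simp flip: ennreal_plus)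
  also have "ennreal (\<Lambda> (T N)) \<le> (\<Sum>i. content (V i))"
    using T_le[of N] sum_le_suminf[of "\<lambda>i. content (V i)" "{..<N}"] by (auto intro: order_trans)
  finally show "ennreal (\<Lambda> \<phi>) \<le> (\<Sum>i. content (V i)) + ennreal e"
    by (simp add: add_right_mono)
qed

lemma outer_measure_space_outer_content: "outer_measure_space (Pow UNIV) outer_content"
  unfolding outer_measure_space_def
proof (intro conjI)
  show "positive (Pow UNIV) outer_content" using outer_content_open[of "{}"] by (simp add: positive_def content_empty)
  show "increasing (Pow UNIV) outer_content" by (auto simp: increasing_def intro: outer_content_mono)
  show "countably_subadditive (Pow UNIV) outer_content" unfolding countably_subadditive_def
  proof (intro allI impI)
    fix A :: "nat \<Rightarrow> 'a set"
    show "outer_content (\<Union>i. A i) \<le> (\<Sum>i. outer_content (A i))"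
    proof (rule ennreal_le_epsilon)
      fix e :: real assume e: "0 < e"
      have "\<exists>U. open U \<and> A i \<subseteq> U \<and> content U \<le> outer_content (A i) + ennreal (e * (1/2) ^ Suc i)" for i
      proof -
        have "outer_content (A i) \<noteq> \<infinity>" using outer_content_le[of UNIV "A i"] content_le_1[of UNIV] by (auto simp: top_unique)
        from INF_approx_ennreal[OF _ outer_content_def this, of "e * (1/2) ^ Suc i"] e
        show ?thesis by (auto intro: less_imp_le)
      qed
      then obtain U where U: "\<And>i. open (U i)" "\<And>i. A i \<subseteq> U i" "\<And>i. content (U i) \<le> outer_content (A i) + ennreal (e * (1/2) ^ Suc i)"
        by metis
      have "outer_content (\<Union>i. A i) \<le> content (\<Union>i. U i)" using U by (intro outer_content_le) auto
      also have "\<dots> \<le> (\<Sum>i. content (U i))" using U by (intro content_subadditive) auto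
      also have "\<dots> \<le> (\<Sum>i. outer_content (A i) + ennreal (e * (1/2) ^ Suc i))" using U(3) by (intro suminf_le) auto
      also have "\<dots> = (\<Sum>i. outer_content (A i)) + (\<Sum>i. ennreal (e * (1/2) ^ Suc i))" by (rule suminf_add[symmetric]) auto
      also have "(\<Sum>i. ennreal (e * (1/2) ^ Suc i)) = ennreal e"
        using power_half_series sums_mult[OF power_half_series, of e] e by (intro suminf_ennreal_eq) auto
      finally show "outer_content (\<Union>i. A i) \<le> (\<Sum>i. outer_content (A i)) + ennreal e" .
    qed
  qed
qed

text \<open>If \<open>\<phi>\<close> is nearly optimal below \<open>V \<inter> U\<close>, then \<open>V - U\<close> lies in the open set where \<open>\<phi> < e\<close>. A function
\<open>\<psi>\<close> below that set can be added to \<open>max 0 (\<phi> - e)\<close> without leaving the functions below \<open>V\<close>, as the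
supports are disjoint.\<close>

lemma outer_content_split_open:
  assumes U: "open U"
  shows "outer_content (E \<inter> U) + outer_content (E - U) \<le> outer_content E"
  unfolding outer_content_def[of E]
proof (rule INF_greatest, rule ennreal_le_epsilon)
  fix V and e :: real assume "V \<in> {V. open V \<and> E \<subseteq> V}" and e: "0 < e"
  then have V: "open V" "E \<subseteq> V" by auto
  have "outer_content (E \<inter> U) \<le> content (V \<inter> U)" using V U by (intro outer_content_le) auto
  moreover have "outer_content (E - U) \<le> outer_content (V - U)" using V by (intro outer_content_mono) auto
  moreover have "content (V \<inter> U) + outer_content (V - U) \<le> content V + ennreal e"
  proof -
    have "content (V \<inter> U) + outer_content (V - U) = (SUP \<phi>\<in>below (V \<inter> U). ennreal (\<Lambda> \<phi>) + outer_content (V - U))"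
      unfolding content_def using zero_below by (intro ennreal_SUP_add_left[symmetric]) auto
    also have "\<dots> \<le> content V + ennreal e"
    proof (rule SUP_least)
      fix \<phi> assume \<phi>: "\<phi> \<in> below (V \<inter> U)"
      let ?W = "V \<inter> {x. \<phi> x < e}"
      have W: "open ?W" by (intro open_Int V open_Collect_less continuous_intros lipschitz_continuous belowD[OF \<phi>])
      have "V - U \<subseteq> ?W" using belowD(4)[OF \<phi>] e by auto
      then have "outer_content (V - U) \<le> content ?W" by (intro outer_content_le W)
      moreover have "ennreal (\<Lambda> \<phi>) + content ?W \<le> content V + ennreal e"
      proof -
        have "ennreal (\<Lambda> \<phi>) + content ?W = (SUP \<psi>\<in>below ?W. ennreal (\<Lambda> \<phi>) + ennreal (\<Lambda> \<psi>))"
          unfolding content_def using zero_below by (intro ennreal_SUP_add_right) auto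
        also have "\<dots> \<le> content V + ennreal e"
        proof (rule SUP_least)
          fix \<psi> assume \<psi>: "\<psi> \<in> below ?W"
          let ?\<phi> = "\<lambda>x. max 0 (\<phi> x - e)"
          have l: "lipschitz ?\<phi>" "lipschitz \<psi>" "lipschitz \<phi>"
            by (intro lipschitz_closure belowD[OF \<phi>] belowD[OF \<psi>])+
          have "(\<lambda>x. ?\<phi> x + \<psi> x) \<in> below V"
          proof (rule belowI)
            fix x
            show "0 \<le> ?\<phi> x + \<psi> x" using belowD(2)[OF \<psi>, of x] by simp
            show "?\<phi> x + \<psi> x \<le> 1"
              using belowD(3,4)[OF \<psi>, of x] belowD(3)[OF \<phi>, of x] e by (cases "x \<in> ?W") auto
            show "?\<phi> x + \<psi> x = 0" if "x \<notin> V"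
              using that belowD(4)[OF \<psi>, of x] belowD(4)[OF \<phi>, of x] e by auto
          qed (intro lipschitz_add l)
          from content_ge[OF this] have 1: "ennreal (\<Lambda> ?\<phi> + \<Lambda> \<psi>) \<le> content V" by (simp add: add l)
          have "\<Lambda> \<phi> \<le> \<Lambda> (\<lambda>x. ?\<phi> x + e)" by (intro mono lipschitz_add lipschitz_const l) auto
          then have "\<Lambda> \<phi> \<le> \<Lambda> ?\<phi> + e" by (simp add: add l lipschitz_const const)
          moreover have "0 \<le> \<Lambda> \<phi>" "0 \<le> \<Lambda> \<psi>" "0 \<le> \<Lambda> ?\<phi>"
            using belowD[OF \<phi>] belowD[OF \<psi>] by (auto intro!: nonneg l)
          ultimately have "ennreal (\<Lambda> \<phi>) + ennreal (\<Lambda> \<psi>) \<le> ennreal (\<Lambda> ?\<phi> + \<Lambda> \<psi>) + ennreal e"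
            using e by (simp flip: ennreal_plus)
          with 1 show "ennreal (\<Lambda> \<phi>) + ennreal (\<Lambda> \<psi>) \<le> content V + ennreal e"
            by (meson add_right_mono order_trans)
        qed
        finally show ?thesis .
      qed
      ultimately show "ennreal (\<Lambda> \<phi>) + outer_content (V - U) \<le> content V + ennreal e"
        by (meson add_left_mono order_trans)
    qed
    finally show ?thesis .
  qed
  ultimately show "outer_content (E \<inter> U) + outer_content (E - U) \<le> content V + ennreal e"
    by (meson add_mono order_trans)
qed

definition riesz_measure :: "'a measure" where
  "riesz_measure = measure_of UNIV (sets borel) outer_content"

text \<open>Open sets satisfy the Caratheodory criterion by the previous lemma, hence so do all Borel sets.\<close>

lemma
  shows sets_riesz_measure: "sets riesz_measure = sets borel"
    and emeasure_riesz_measure: "A \<in> sets borel \<Longrightarrow> emeasure riesz_measure A = outer_content A"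
proof -
  show s: "sets riesz_measure = sets borel"
    using sets.sigma_sets_eq[of "borel :: 'a measure"] by (simp add: riesz_measure_def)
  let ?L = "lambda_system UNIV (Pow UNIV) outer_content"
  interpret Pow: sigma_algebra "UNIV :: 'a set" "Pow UNIV" by (rule sigma_algebra_Pow)
  have L: "measure_space UNIV ?L outer_content"
    by (rule Pow.caratheodory_lemma[OF outer_measure_space_outer_content])
  then interpret L: sigma_algebra UNIV ?L by (simp add: measure_space_def)
  have "subadditive (Pow UNIV) outer_content"
    using outer_measure_space_outer_content unfolding outer_measure_space_def
    by (intro Pow.countably_subadditive_subadditive) auto
  then have sub: "outer_content E \<le> outer_content (E \<inter> U) + outer_content (E - U)" for E U
    unfolding subadditive_def using Int_Diff_Un[of E U] Int_Diff_disjoint[of E U] by (metis Pow_UNIV UNIV_I)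
  have "U \<in> ?L" if "open U" for U
    unfolding Pow.lambda_system_eq using antisym[OF outer_content_split_open[OF that] sub] by auto
  then have "{U. open U} \<subseteq> ?L" by blast
  from L.sigma_sets_subset[OF this] have "sets borel \<subseteq> ?L"
    by (simp only: borel_def) (subst sets_measure_of; simp)
  from measure_down[OF L _ this] have "measure_space UNIV (sets borel) outer_content"
    using sets.sigma_algebra_axioms[of "borel :: 'a measure"] by simp
  then show "emeasure riesz_measure A = outer_content A" if "A \<in> sets borel"
    using that s by (intro emeasure_measure_of[OF riesz_measure_def]) (auto simp: measure_space_def)
qed

lemma riesz_measure_prob: "riesz_measure \<in> prob_measures"
proof -
  have "space riesz_measure = UNIV"
    using sets_eq_imp_space_eq[OF sets_riesz_measure] by simp
  then have "prob_space riesz_measure"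
    by (intro prob_spaceI) (simp add: emeasure_riesz_measure outer_content_open content_UNIV)
  then show ?thesis by (simp add: prob_measures_def sets_riesz_measure)
qed

lemma lipschitz_integrable_riesz_measure: "lipschitz \<phi> \<Longrightarrow> integrable riesz_measure \<phi>"
  using lipschitz_integrable[OF K _ riesz_measure_prob] by (auto simp: lipschitz_def)

text \<open>Cut \<open>\<phi>\<close> into \<open>N\<close> horizontal slices \<open>s i\<close> of height \<open>1 / N\<close>. The functional of a slice is at most
\<open>1 / N\<close> times the measure of \<open>{x. i / N < \<phi> x}\<close>, which in turn is at most the integral of the slice
underneath. Only the bottom slice has none underneath, which costs \<open>1 / N\<close>.\<close>

lemma functional_le_integral:
  assumes \<phi>: "lipschitz \<phi>" "\<And>x. 0 \<le> \<phi> x" "\<And>x. \<phi> x \<le> 1"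
  shows "\<Lambda> \<phi> \<le> (LINT x|riesz_measure. \<phi> x)"
proof -
  interpret prob_space riesz_measure using riesz_measure_prob by (simp add: prob_measures_def)
  have sp: "space riesz_measure = UNIV"
    using sets_eq_imp_space_eq[OF sets_riesz_measure] by simp
  have "\<Lambda> \<phi> \<le> (LINT x|riesz_measure. \<phi> x) + inverse (real (Suc n))" for n
  proof -
    define N where "N = real (Suc n)"
    have N: "0 < N" by (simp add: N_def)
    define s where "s i x = min (1 / N) (max 0 (\<phi> x - real i / N))" for i x
    have s: "lipschitz (s i)" for i unfolding s_def by (intro lipschitz_closure \<phi>(1))
    define U where "U i = {x. real i / N < \<phi> x}" for i
    have U: "open (U i)" for i unfolding U_def
      by (intro open_Collect_less continuous_intros lipschitz_continuous \<phi>(1))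
    have sum_s: "(\<Sum>i<j. s i x) = min (real j / N) (\<phi> x)" for j x
    proof (induction j)
      case (Suc j)
      have "real (Suc j) / N = real j / N + 1 / N" by (simp add: add_divide_distrib)
      moreover have "0 < 1 / N" using N by simp
      ultimately show ?case using Suc unfolding sum.lessThan_Suc s_def by linarith
    qed (use \<phi>(2)[of x] in simp)
    have \<phi>_eq: "\<phi> x = (\<Sum>i<Suc n. s i x)" for x
      unfolding sum_s using \<phi>(3)[of x] by (simp add: N_def)
    have upper: "\<Lambda> (s i) \<le> measure riesz_measure (U i) / N" for i
    proof -
      have "(\<lambda>x. N * s i x) \<in> below (U i)"
      proof (rule belowI)
        fix x
        show "0 \<le> N * s i x" using N by (simp add: s_def)
        have "s i x \<le> 1 / N" by (simp add: s_def)
        then show "N * s i x \<le> 1" using N by (simp add: field_simps)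
        show "N * s i x = 0" if "x \<notin> U i" using that N by (simp add: s_def U_def)
      qed (intro lipschitz_cmult s)
      from content_ge[OF this] have "ennreal (N * \<Lambda> (s i)) \<le> emeasure riesz_measure (U i)"
        using U by (simp add: cmult s emeasure_riesz_measure outer_content_open)
      then show ?thesis using N by (simp add: emeasure_eq_measure field_simps)
    qed
    have lower: "measure riesz_measure (U (Suc i)) / N \<le> (LINT x|riesz_measure. s i x)" for i
    proof -
      have "(LINT x|riesz_measure. indicator (U (Suc i)) x / N) \<le> (LINT x|riesz_measure. s i x)"
      proof (rule integral_mono)
        show "integrable riesz_measure (\<lambda>x. indicator (U (Suc i)) x / N)"
          using U[of "Suc i"] by (intro integrable_divide integrable_indicator) (simp_all add: sets_riesz_measure less_top[symmetric])
        show "indicator (U (Suc i)) x / N \<le> s i x" for x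
          using N by (auto simp: s_def U_def add_divide_distrib split: split_indicator)
      qed (rule lipschitz_integrable_riesz_measure[OF s])
      then show ?thesis using U[of "Suc i"] by (simp add: sp)
    qed
    have "\<Lambda> \<phi> = \<Lambda> (\<lambda>x. \<Sum>i<Suc n. s i x)" using \<phi>_eq by presburger
    also have "\<dots> = (\<Sum>i<Suc n. \<Lambda> (s i))" by (intro sum s) simp
    also have "\<dots> \<le> (\<Sum>i<Suc n. measure riesz_measure (U i) / N)" by (intro sum_mono upper)
    also have "\<dots> = measure riesz_measure (U 0) / N + (\<Sum>i<n. measure riesz_measure (U (Suc i)) / N)"
      by (rule sum.lessThan_Suc_shift)
    also have "\<dots> \<le> 1 / N + (\<Sum>i<n. LINT x|riesz_measure. s i x)"
      using N by (intro add_mono sum_mono lower divide_right_mono) auto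
    also have "(\<Sum>i<n. LINT x|riesz_measure. s i x) = (LINT x|riesz_measure. (\<Sum>i<n. s i x))"
      by (rule Bochner_Integration.integral_sum[symmetric]) (rule lipschitz_integrable_riesz_measure[OF s])
    also have "\<dots> \<le> (LINT x|riesz_measure. \<phi> x)"
      by (intro integral_mono lipschitz_integrable_riesz_measure \<phi>(1) lipschitz_sum s) (simp add: sum_s)
    finally show ?thesis by (simp add: N_def inverse_eq_divide)
  qed
  note le = this
  show ?thesis
  proof (rule field_le_epsilon)
    fix e :: real assume "0 < e"
    then obtain n where "inverse (real (Suc n)) < e" using reals_Archimedean by blast
    with le[of n] show "\<Lambda> \<phi> \<le> (LINT x|riesz_measure. \<phi> x) + e" by linarith
  qed
qed

text \<open>The inequality just proved, applied to \<open>\<psi>\<close> and to \<open>1 - \<psi>\<close>, is an equality for \<open>0 \<le> \<psi> \<le> 1\<close>; an affine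
change reduces the general case to this one.\<close>

theorem functional_eq_integral:
  assumes \<phi>: "lipschitz \<phi>"
  shows "\<Lambda> \<phi> = (LINT x|riesz_measure. \<phi> x)"
proof -
  interpret prob_space riesz_measure using riesz_measure_prob by (simp add: prob_measures_def)
  obtain B where B: "0 < B" "\<And>x. \<bar>\<phi> x\<bar> \<le> B"
  proof -
    have "bounded (range \<phi>)"
      using compact_continuous_image[OF lipschitz_continuous[OF \<phi>] K] compact_imp_bounded by blast
    then show thesis using that by (auto simp: bounded_pos)
  qed
  let ?\<psi> = "\<lambda>x. 1 / (2 * B) * (\<phi> x + B)"
  have \<psi>: "lipschitz ?\<psi>" by (intro lipschitz_closure \<phi>)
  have "0 \<le> \<phi> x + B" "\<phi> x + B \<le> 2 * B" for x using B(2)[of x] by linarith+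
  then have b: "0 \<le> ?\<psi> x" "?\<psi> x \<le> 1" for x using B(1) by (auto simp: field_simps)
  have "\<Lambda> ?\<psi> \<le> (LINT x|riesz_measure. ?\<psi> x)"
    by (intro functional_le_integral \<psi> b)
  moreover have "\<Lambda> (\<lambda>x. 1 - ?\<psi> x) \<le> (LINT x|riesz_measure. 1 - ?\<psi> x)"
    using b by (intro functional_le_integral lipschitz_diff lipschitz_const \<psi>) auto
  moreover have "(LINT x|riesz_measure. 1 - ?\<psi> x) = 1 - (LINT x|riesz_measure. ?\<psi> x)"
    using lipschitz_integrable_riesz_measure[OF \<psi>] by (subst Bochner_Integration.integral_diff) (auto simp: prob_space)
  moreover have "\<Lambda> (\<lambda>x. 1 - ?\<psi> x) = 1 - \<Lambda> ?\<psi>" using diff[OF lipschitz_const \<psi>, of 1] by (simp add: one)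
  ultimately have "\<Lambda> ?\<psi> = (LINT x|riesz_measure. ?\<psi> x)" by linarith
  moreover have "\<Lambda> ?\<psi> = 1 / (2 * B) * (\<Lambda> \<phi> + B)"
    by (simp only: cmult[OF lipschitz_add[OF \<phi> lipschitz_const]] add[OF \<phi> lipschitz_const] const)
  moreover have "(LINT x|riesz_measure. ?\<psi> x) = 1 / (2 * B) * ((LINT x|riesz_measure. \<phi> x) + B)"
    using lipschitz_integrable_riesz_measure[OF \<phi>] by (simp add: prob_space)
  ultimately show ?thesis using B(1) by simp
qed

end

text \<open>The limit of the integrals is a normalised positive linear functional.\<close>

lemma prob_measures_limit_of_integrals:
  fixes \<mu> :: "nat \<Rightarrow> 'a::metric_space measure"
  assumes K: "compact (UNIV :: 'a set)" and \<mu>: "\<And>n. \<mu> n \<in> prob_measures"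
    and conv: "\<And>\<phi> :: 'a \<Rightarrow> real. 1-lipschitz_on UNIV \<phi> \<Longrightarrow> convergent (\<lambda>n. LINT x|\<mu> n. \<phi> x)"
  obtains \<nu> where "\<nu> \<in> prob_measures"
    "\<And>\<phi> :: 'a \<Rightarrow> real. 1-lipschitz_on UNIV \<phi> \<Longrightarrow> (\<lambda>n. LINT x|\<mu> n. \<phi> x) \<longlonglongrightarrow> (LINT x|\<nu>. \<phi> x)"
proof -
  have int: "integrable (\<mu> n) \<phi>" if "lipschitz \<phi>" for n \<phi>
    using lipschitz_integrable[OF K _ \<mu>] that by (auto simp: lipschitz_def)
  define \<Lambda> where "\<Lambda> \<phi> = lim (\<lambda>n. LINT x|\<mu> n. \<phi> x)" for \<phi> :: "'a \<Rightarrow> real"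
  have \<Lambda>: "(\<lambda>n. LINT x|\<mu> n. \<phi> x) \<longlonglongrightarrow> \<Lambda> \<phi>" if l: "lipschitz \<phi>" for \<phi>
  proof -
    obtain L where L: "L-lipschitz_on UNIV \<phi>" using l by (auto simp: lipschitz_def)
    have L0: "0 \<le> L" using lipschitz_on_nonneg[OF L] .
    have "1-lipschitz_on UNIV (\<lambda>x. inverse (L + 1) * \<phi> x)"
    proof (rule lipschitz_onI)
      fix x y
      have "dist (\<phi> x) (\<phi> y) \<le> L * dist x y" by (rule lipschitz_onD[OF L]) auto
      also have "\<dots> \<le> (L + 1) * dist x y" by (intro mult_right_mono) auto
      finally have "inverse (L + 1) * dist (\<phi> x) (\<phi> y) \<le> inverse (L + 1) * ((L + 1) * dist x y)"
        using L0 by (intro mult_left_mono) auto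
      then show "dist (inverse (L + 1) * \<phi> x) (inverse (L + 1) * \<phi> y) \<le> 1 * dist x y"
        using L0 by (simp add: dist_real_def right_diff_distrib[symmetric] abs_mult mult.assoc[symmetric])
    qed simp
    from convergent_mult_const_iff[of "inverse (L + 1)"] conv[OF this] L0
    have "convergent (\<lambda>n. LINT x|\<mu> n. \<phi> x)" by simp
    then show ?thesis by (simp add: \<Lambda>_def convergent_LIMSEQ_iff)
  qed
  interpret positive_functional \<Lambda>
  proof
    fix \<phi> \<psi> :: "'a \<Rightarrow> real" assume l: "lipschitz \<phi>" "lipschitz \<psi>"
    show "\<Lambda> (\<lambda>x. \<phi> x + \<psi> x) = \<Lambda> \<phi> + \<Lambda> \<psi>"
      using LIMSEQ_unique[OF \<Lambda>[OF lipschitz_add[OF l]]] tendsto_add[OF \<Lambda>[OF l(1)] \<Lambda>[OF l(2)]] int[OF l(1)] int[OF l(2)]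
      by simp
  next
    fix c and \<phi> :: "'a \<Rightarrow> real" assume l: "lipschitz \<phi>"
    show "\<Lambda> (\<lambda>x. c * \<phi> x) = c * \<Lambda> \<phi>"
      using LIMSEQ_unique[OF \<Lambda>[OF lipschitz_cmult[OF l]]] tendsto_mult_left[OF \<Lambda>[OF l], of c] by simp
  next
    fix \<phi> :: "'a \<Rightarrow> real" assume "lipschitz \<phi>" "\<And>x. 0 \<le> \<phi> x"
    then show "0 \<le> \<Lambda> \<phi>" by (intro LIMSEQ_le_const[OF \<Lambda>]) auto
  next
    have "(\<lambda>n. LINT x|\<mu> n. (1::real)) = (\<lambda>n. 1)"
    proof
      fix n
      interpret prob_space "\<mu> n" using \<mu>[of n] by (simp add: prob_measures_def)
      show "(LINT x|\<mu> n. (1::real)) = 1" by (simp add: prob_space)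
    qed
    then show "\<Lambda> (\<lambda>_. 1) = 1" using LIMSEQ_unique[OF \<Lambda>[OF lipschitz_const, of 1]] by simp
  qed (rule K)
  show thesis
  proof (rule that[OF riesz_measure_prob])
    fix \<phi> :: "'a \<Rightarrow> real" assume "1-lipschitz_on UNIV \<phi>"
    then have "lipschitz \<phi>" by (auto simp: lipschitz_def)
    then show "(\<lambda>n. LINT x|\<mu> n. \<phi> x) \<longlonglongrightarrow> (LINT x|riesz_measure. \<phi> x)"
      using \<Lambda> functional_eq_integral by simp
  qed
qed

text \<open>Along a Cauchy sequence the integrals of a \<open>1\<close>-Lipschitz function converge, so a candidate limit
exists; the Cauchy estimate is uniform over all such functions and passes to the limit.\<close>

theorem mcomplete_prob_measures:
  assumes K: "compact (UNIV :: 'a::metric_space set)"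
  shows "Metric_space.mcomplete (prob_measures :: 'a measure set) kant_dist"
proof -
  interpret Metric_space "prob_measures :: 'a measure set" kant_dist
    by (rule Metric_space_prob_measures[OF K])
  show ?thesis unfolding mcomplete_def
  proof (intro allI impI)
    fix \<mu> :: "nat \<Rightarrow> 'a measure" assume C: "MCauchy \<mu>"
    then have \<mu>: "\<mu> n \<in> prob_measures" for n by (auto simp: MCauchy_def)
    have Cau: "\<exists>N. \<forall>m\<ge>N. \<forall>n\<ge>N. kant_dist (\<mu> m) (\<mu> n) < e" if e: "0 < e" for e
    proof -
      have "\<exists>N. \<forall>m n. N \<le> m \<longrightarrow> N \<le> n \<longrightarrow> kant_dist (\<mu> m) (\<mu> n) < e"
        using C e unfolding MCauchy_def by simp
      then show ?thesis by blast
    qed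
    have le: "\<bar>(LINT x|\<mu> m. \<phi> x) - (LINT x|\<mu> n. \<phi> x)\<bar> \<le> kant_dist (\<mu> m) (\<mu> n)"
      if "1-lipschitz_on UNIV \<phi>" for \<phi> :: "'a \<Rightarrow> real" and m n
      using kant_dist_ge[OF K that \<mu> \<mu>, of m n] kant_dist_ge[OF K that \<mu> \<mu>, of n m] commute[of "\<mu> m" "\<mu> n"]
      by linarith
    have "convergent (\<lambda>n. LINT x|\<mu> n. \<phi> x)" if "1-lipschitz_on UNIV \<phi>" for \<phi> :: "'a \<Rightarrow> real"
    proof (rule Cauchy_convergent, rule metric_CauchyI)
      fix e :: real assume "0 < e"
      then show "\<exists>M. \<forall>m\<ge>M. \<forall>n\<ge>M. dist (LINT x|\<mu> m. \<phi> x) (LINT x|\<mu> n. \<phi> x) < e"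
        using Cau[of e] le[OF that] unfolding dist_real_def by (metis le_less_trans)
    qed
    then obtain \<nu> where \<nu>: "\<nu> \<in> prob_measures"
      "\<And>\<phi> :: 'a \<Rightarrow> real. 1-lipschitz_on UNIV \<phi> \<Longrightarrow> (\<lambda>n. LINT x|\<mu> n. \<phi> x) \<longlonglongrightarrow> (LINT x|\<nu>. \<phi> x)"
      using prob_measures_limit_of_integrals[where \<mu> = \<mu>, OF K \<mu>] by blast
    have "\<forall>\<^sub>F n in sequentially. \<mu> n \<in> prob_measures \<and> kant_dist (\<mu> n) \<nu> < e" if e: "0 < e" for e
    proof -
      obtain N where N: "\<And>m n. N \<le> m \<Longrightarrow> N \<le> n \<Longrightarrow> kant_dist (\<mu> m) (\<mu> n) < e / 2"
        using Cau[of "e / 2"] e by auto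
      have "kant_dist (\<mu> n) \<nu> \<le> e / 2" if n: "N \<le> n" for n
      proof (rule kant_dist_leI[OF \<mu> \<nu>(1)])
        fix \<phi> :: "'a \<Rightarrow> real" assume \<phi>: "1-lipschitz_on UNIV \<phi>"
        show "(LINT x|\<mu> n. \<phi> x) - (LINT x|\<nu>. \<phi> x) \<le> e / 2"
        proof (rule LIMSEQ_le_const2)
          show "(\<lambda>m. (LINT x|\<mu> n. \<phi> x) - (LINT x|\<mu> m. \<phi> x)) \<longlonglongrightarrow> (LINT x|\<mu> n. \<phi> x) - (LINT x|\<nu>. \<phi> x)"
            by (intro tendsto_intros \<nu>(2) \<phi>)
          show "\<exists>M. \<forall>m\<ge>M. (LINT x|\<mu> n. \<phi> x) - (LINT x|\<mu> m. \<phi> x) \<le> e / 2"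
          proof (intro exI allI impI)
            fix m assume "N \<le> m"
            then show "(LINT x|\<mu> n. \<phi> x) - (LINT x|\<mu> m. \<phi> x) \<le> e / 2"
              using le[OF \<phi>, of n m] N[OF n, of m] by linarith
          qed
        qed
      qed
      then show ?thesis using e \<mu> unfolding eventually_sequentially
        by (intro exI[of _ N]) (auto intro: le_less_trans[of _ "e / 2"])
    qed
    then show "\<exists>\<nu>. limitin mtopology \<mu> \<nu> sequentially"
      using \<nu>(1) unfolding limit_metric_sequentially eventually_sequentially by blast
  qed
qed

section \<open>Measurability of the empirical limit\<close>

text \<open>As the law of \<open>f ^^ k\<close> at \<open>x\<close> for a uniformly random \<open>k < n\<close>, the empirical measure becomes accessible
to the theory of image measures.\<close>

lemma empirical_measure_eq_distr:
  assumes "0 < n"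
  shows "empirical_measure f n x = distr (measure_pmf (pmf_of_set {..<n})) borel (\<lambda>k. (f ^^ k) x)"
proof -
  have "(\<Sum>k<n. emeasure (return borel ((f ^^ k) x)) A) / of_nat n =
      emeasure (measure_pmf (pmf_of_set {..<n})) ((\<lambda>k. (f ^^ k) x) -` A \<inter> space (measure_pmf (pmf_of_set {..<n})))"
    if A: "A \<in> sets borel" for A
  proof -
    have "(\<Sum>k<n. emeasure (return borel ((f ^^ k) x)) A) = (\<Sum>k<n. indicator ((\<lambda>k. (f ^^ k) x) -` A) k)"
      using A by (intro sum.cong) (auto split: split_indicator)
    also have "\<dots> = of_nat (card ({..<n} \<inter> (\<lambda>k. (f ^^ k) x) -` A))"
      by (simp add: indicator_def[abs_def] sum.If_cases Int_def)
    finally show ?thesis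
      using assms by (simp add: emeasure_pmf_of_set lessThan_empty_iff divide_ennreal ennreal_of_nat_eq_real_of_nat)
  qed
  then show ?thesis unfolding empirical_measure_def distr_def space_borel
    using sets.sigma_sets_eq[of "borel :: 'a measure"] by (intro measure_of_eq) auto
qed

lemma empirical_measure_prob:
  assumes "0 < n"
  shows "empirical_measure f n x \<in> prob_measures"
proof -
  have "prob_space (distr (measure_pmf (pmf_of_set {..<n})) borel (\<lambda>k. (f ^^ k) x))"
    by (rule measure_pmf.prob_space_distr) simp
  then show ?thesis by (simp add: empirical_measure_eq_distr[OF assms] prob_measures_def)
qed

lemma integral_empirical_measure:
  fixes \<psi> :: "'a::metric_space \<Rightarrow> real"
  assumes "0 < n" "\<psi> \<in> borel_measurable borel"
  shows "(LINT y|empirical_measure f n x. \<psi> y) = (\<Sum>k<n. \<psi> ((f ^^ k) x)) / real n"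
proof -
  have "(LINT y|empirical_measure f n x. \<psi> y) = (LINT k|measure_pmf (pmf_of_set {..<n}). \<psi> ((f ^^ k) x))"
    unfolding empirical_measure_eq_distr[OF assms(1)] using assms(2) by (intro integral_distr) simp_all
  also have "\<dots> = (\<Sum>k<n. \<psi> ((f ^^ k) x)) / real n"
    using assms(1) by (subst integral_pmf_of_set) auto
  finally show ?thesis .
qed

lemma continuous_on_funpow:
  fixes f :: "'a::topological_space \<Rightarrow> 'a"
  shows "continuous_on UNIV f \<Longrightarrow> continuous_on UNIV (f ^^ k)"
proof (induction k)
  case (Suc k)
  then show ?case using continuous_on_compose[of UNIV "f ^^ k" f] continuous_on_subset[of UNIV f] by simp
qed (simp add: id_def)

lemma measurable_empirical_measure:
  fixes f :: "'a::metric_space \<Rightarrow> 'a"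
  assumes K: "compact (UNIV :: 'a set)" and f: "continuous_on UNIV f" and n: "0 < n"
  shows "empirical_measure f n \<in> measurable borel prob_borel"
proof (rule measurable_prob_borelI[OF K])
  show "empirical_measure f n \<in> space borel \<rightarrow> prob_measures" using empirical_measure_prob[OF n] by auto
  fix \<psi> :: "'a \<Rightarrow> real" assume "1-lipschitz_on UNIV \<psi>"
  then have [measurable]: "\<psi> \<in> borel_measurable borel"
    by (intro borel_measurable_continuous_onI lipschitz_on_continuous_on)
  have [measurable]: "(\<lambda>x. (f ^^ k) x) \<in> borel_measurable borel" for k
    by (intro borel_measurable_continuous_onI continuous_on_funpow f)
  have "(\<lambda>x. (\<Sum>k<n. \<psi> ((f ^^ k) x)) / real n) \<in> borel_measurable borel" by measurable
  then show "(\<lambda>x. LINT y|empirical_measure f n x. \<psi> y) \<in> borel_measurable borel"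
    by (simp add: integral_empirical_measure n)
qed

text \<open>Completeness replaces the uncountable quantifier over limits by countably many conditions on
distances, which define a Borel set of points. The index is shifted since the empirical measure of
length \<open>0\<close> is not a probability measure.\<close>

lemma has_empirical_limit_iff_Cauchy:
  fixes f :: "'a::metric_space \<Rightarrow> 'a"
  assumes K: "compact (UNIV :: 'a set)"
  shows "(\<exists>\<nu>. has_empirical_limit f x \<nu>) \<longleftrightarrow>
    (\<forall>m. \<exists>N. \<forall>i\<ge>N. \<forall>j\<ge>N. kant_dist (empirical_measure f (Suc i) x) (empirical_measure f (Suc j) x) < inverse (real (Suc m)))"
    (is "?lim \<longleftrightarrow> ?Cauchy")
proof -
  interpret Metric_space "prob_measures :: 'a measure set" kant_dist
    by (rule Metric_space_prob_measures[OF K])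
  let ?\<sigma> = "\<lambda>n. empirical_measure f (Suc n) x"
  have "?Cauchy \<longleftrightarrow> MCauchy ?\<sigma>"
  proof
    assume C: ?Cauchy
    show "MCauchy ?\<sigma>" unfolding MCauchy_def
    proof (intro conjI allI impI)
      fix e :: real assume "0 < e"
      then obtain m where "inverse (real (Suc m)) < e" using reals_Archimedean by blast
      moreover obtain N where "\<forall>i\<ge>N. \<forall>j\<ge>N. kant_dist (?\<sigma> i) (?\<sigma> j) < inverse (real (Suc m))"
        using C by presburger
      ultimately show "\<exists>N. \<forall>n n'. N \<le> n \<longrightarrow> N \<le> n' \<longrightarrow> kant_dist (?\<sigma> n) (?\<sigma> n') < e"
        by (intro exI[of _ N]) (auto intro: less_trans)
    qed (auto simp: empirical_measure_prob)
  next
    assume "MCauchy ?\<sigma>"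
    then have C: "\<And>e. 0 < e \<Longrightarrow> \<exists>N. \<forall>n n'. N \<le> n \<longrightarrow> N \<le> n' \<longrightarrow> kant_dist (?\<sigma> n) (?\<sigma> n') < e"
      unfolding MCauchy_def by simp
    show ?Cauchy
    proof
      fix m
      have "0 < inverse (real (Suc m))" by simp
      from C[OF this] show "\<exists>N. \<forall>i\<ge>N. \<forall>j\<ge>N. kant_dist (?\<sigma> i) (?\<sigma> j) < inverse (real (Suc m))"
        by blast
    qed
  qed
  also have "\<dots> \<longleftrightarrow> (\<exists>\<nu>. limitin mtopology ?\<sigma> \<nu> sequentially)"
  proof
    show "MCauchy ?\<sigma> \<Longrightarrow> \<exists>\<nu>. limitin mtopology ?\<sigma> \<nu> sequentially"
      using mcomplete_prob_measures[OF K] by (simp add: mcomplete_def)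
    show "\<exists>\<nu>. limitin mtopology ?\<sigma> \<nu> sequentially \<Longrightarrow> MCauchy ?\<sigma>"
      by (auto intro!: convergent_imp_MCauchy simp: empirical_measure_prob)
  qed
  also have "\<dots> \<longleftrightarrow> ?lim" unfolding has_empirical_limit_def
    using limitin_sequentially_offset[of mtopology "\<lambda>n. empirical_measure f n x" _ 1]
      limitin_sequentially_offset_rev[of mtopology "\<lambda>n. empirical_measure f n x" 1] by auto
  finally show ?thesis by simp
qed

lemma empirical_limit_eq:
  fixes f :: "'a::metric_space \<Rightarrow> 'a"
  assumes K: "compact (UNIV :: 'a set)" and \<nu>: "has_empirical_limit f x \<nu>"
  shows "empirical_limit f x = \<nu>"
proof -
  interpret Metric_space "prob_measures :: 'a measure set" kant_dist
    by (rule Metric_space_prob_measures[OF K])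
  have "\<nu>' = \<nu>" if "has_empirical_limit f x \<nu>'" for \<nu>'
    using that \<nu> unfolding has_empirical_limit_def
    by (rule limitin_metric_unique) (rule trivial_limit_sequentially)
  then have "(THE \<nu>. has_empirical_limit f x \<nu>) = \<nu>"
    using \<nu> by (intro the_equality)
  moreover have "\<exists>\<nu>. has_empirical_limit f x \<nu>" using \<nu> by (rule exI)
  ultimately show ?thesis unfolding empirical_limit_def by (simp only: if_True)
qed

lemma integral_empirical_limit:
  fixes f :: "'a::metric_space \<Rightarrow> 'a" and \<psi> :: "'a \<Rightarrow> real"
  assumes K: "compact (UNIV :: 'a set)" and \<nu>: "has_empirical_limit f x \<nu>" and \<psi>: "1-lipschitz_on UNIV \<psi>"
  shows "(LINT y|\<nu>. \<psi> y) = lim (\<lambda>n. LINT y|empirical_measure f (Suc n) x. \<psi> y)"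
proof -
  interpret Metric_space "prob_measures :: 'a measure set" kant_dist
    by (rule Metric_space_prob_measures[OF K])
  have M: "\<nu> \<in> prob_measures" and conv: "\<And>e. 0 < e \<Longrightarrow> \<exists>N. \<forall>n\<ge>N. kant_dist (empirical_measure f n x) \<nu> < e"
    using \<nu> unfolding has_empirical_limit_def limit_metric_sequentially by blast+
  have "(\<lambda>n. LINT y|empirical_measure f (Suc n) x. \<psi> y) \<longlonglongrightarrow> (LINT y|\<nu>. \<psi> y)"
  proof (rule metric_LIMSEQ_I)
    fix e :: real assume "0 < e"
    then obtain N where N: "\<And>n. N \<le> n \<Longrightarrow> kant_dist (empirical_measure f n x) \<nu> < e" using conv by metis
    have "dist (LINT y|empirical_measure f (Suc n) x. \<psi> y) (LINT y|\<nu>. \<psi> y) < e" if "N \<le> n" for n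
    proof -
      let ?E = "empirical_measure f (Suc n) x"
      have E: "?E \<in> prob_measures" by (simp add: empirical_measure_prob)
      have "kant_dist ?E \<nu> < e" using N[of "Suc n"] that by simp
      then show ?thesis
        using kant_dist_ge[OF K \<psi> E M] kant_dist_ge[OF K \<psi> M E] commute[of \<nu> ?E]
        unfolding dist_real_def by linarith
    qed
    then show "\<exists>N. \<forall>n\<ge>N. dist (LINT y|empirical_measure f (Suc n) x. \<psi> y) (LINT y|\<nu>. \<psi> y) < e" by blast
  qed
  then show ?thesis by (rule limI[symmetric])
qed

text \<open>On the Borel set of convergence the integral of a Lipschitz function against the limit is a pointwise
limit of Birkhoff averages; off that set it is the value of the function, the limit being replaced by a
Dirac measure.\<close>

lemma measurable_empirical_limit:
  fixes f :: "'a::metric_space \<Rightarrow> 'a"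
  assumes K: "compact (UNIV :: 'a set)" and f: "continuous_on UNIV f"
  shows "empirical_limit f \<in> measurable borel prob_borel"
proof (rule measurable_prob_borelI[OF K])
  interpret Metric_space "prob_measures :: 'a measure set" kant_dist
    by (rule Metric_space_prob_measures[OF K])
  define L where "L = {x. \<exists>\<nu>. has_empirical_limit f x \<nu>}"
  have off: "empirical_limit f x = return borel x" if "x \<notin> L" for x
    using that by (simp add: L_def empirical_limit_def)
  show "empirical_limit f \<in> space borel \<rightarrow> prob_measures"
  proof
    fix x
    show "empirical_limit f x \<in> prob_measures"
    proof (cases "x \<in> L")
      case True
      then obtain \<nu> where "has_empirical_limit f x \<nu>" by (auto simp: L_def)
      then show ?thesis
        using empirical_limit_eq[OF K, of f x \<nu>] limitin_mspace[of _ \<nu>] by (auto simp: has_empirical_limit_def)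
    next
      case False
      then show ?thesis by (auto simp: off prob_measures_def intro: prob_space_return)
    qed
  qed
  fix \<psi> :: "'a \<Rightarrow> real" assume \<psi>: "1-lipschitz_on UNIV \<psi>"
  then have [measurable]: "\<psi> \<in> borel_measurable borel"
    by (intro borel_measurable_continuous_onI lipschitz_on_continuous_on)
  note [measurable] = measurable_empirical_measure[OF K f zero_less_Suc]
  have [measurable]: "(\<lambda>x. kant_dist (empirical_measure f (Suc i) x) (empirical_measure f (Suc j) x)) \<in> borel_measurable borel" for i j
    using measurable_compose[OF measurable_Pair measurable_kant_dist[OF K], of "empirical_measure f (Suc i)" borel "empirical_measure f (Suc j)"]
    by simp
  have L [measurable]: "L \<in> sets borel"
  proof -
    have "Measurable.pred borel (\<lambda>x. \<forall>m. \<exists>N. \<forall>i. N \<le> i \<longrightarrow> (\<forall>j. N \<le> j \<longrightarrow>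
        kant_dist (empirical_measure f (Suc i) x) (empirical_measure f (Suc j) x) < inverse (real (Suc m))))"
      by measurable
    then show ?thesis unfolding L_def has_empirical_limit_iff_Cauchy[OF K] by (simp add: pred_def)
  qed
  have [measurable]: "(\<lambda>x. LINT y|empirical_measure f (Suc n) x. \<psi> y) \<in> borel_measurable borel" for n
    using measurable_compose[OF measurable_empirical_measure[OF K f zero_less_Suc] measurable_integral_prob_borel[OF K \<psi>]] .
  have "(\<lambda>x. if x \<in> L then lim (\<lambda>n. LINT y|empirical_measure f (Suc n) x. \<psi> y) else \<psi> x) \<in> borel_measurable borel"
    by measurable
  also have "(\<lambda>x. if x \<in> L then lim (\<lambda>n. LINT y|empirical_measure f (Suc n) x. \<psi> y) else \<psi> x)
      = (\<lambda>x. LINT y|empirical_limit f x. \<psi> y)"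
  proof
    fix x
    show "(if x \<in> L then lim (\<lambda>n. LINT y|empirical_measure f (Suc n) x. \<psi> y) else \<psi> x) = (LINT y|empirical_limit f x. \<psi> y)"
    proof (cases "x \<in> L")
      case True
      then obtain \<nu> where "has_empirical_limit f x \<nu>" by (auto simp: L_def)
      then show ?thesis using True empirical_limit_eq[OF K] integral_empirical_limit[OF K _ \<psi>] by simp
    next
      case False
      then show ?thesis by (simp add: off integral_return)
    qed
  qed
  finally show "(\<lambda>x. LINT y|empirical_limit f x. \<psi> y) \<in> borel_measurable borel" .
qed

section \<open>Local emergence of a mixture\<close>

text \<open>The almost sure comparison of ball masses bounds the scale of \<open>P\<close> by that of \<open>Q\<close>; the domination
\<open>t P \<le> Q\<close> gives the other bound, where the constant \<open>1 / t\<close> is eventually below \<open>(- ln \<epsilon>) ^ 3\<close>.\<close>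

lemma AE_local_scl_eq:
  fixes P Q :: "'a::metric_space measure measure"
  assumes K: "compact (UNIV :: 'a set)"
    and P: "prob_space P" "sets P = sets prob_borel" and Q: "prob_space Q" "sets Q = sets prob_borel"
    and t: "0 < t" and le: "\<And>A. A \<in> sets prob_borel \<Longrightarrow> t * measure P A \<le> measure Q A"
  shows "AE y in P. e2ennreal (upper_local_scl S prob_measures kant_dist P y)
           = e2ennreal (upper_local_scl S prob_measures kant_dist Q y)
       \<and> e2ennreal (lower_local_scl S prob_measures kant_dist P y)
           = e2ennreal (lower_local_scl S prob_measures kant_dist Q y)"
proof -
  interpret Metric_space "prob_measures :: 'a measure set" kant_dist
    by (rule Metric_space_prob_measures[OF K])
  interpret P: prob_space P by (rule P)
  interpret Q: prob_space Q by (rule Q)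
  have sp: "space P = prob_measures" "space Q = prob_measures"
    using sets_eq_imp_space_eq[OF P(2)] sets_eq_imp_space_eq[OF Q(2)] by (simp_all add: space_prob_borel)
  have d: "case_prod kant_dist \<in> borel_measurable (P \<Otimes>\<^sub>M Q)" "case_prod kant_dist \<in> borel_measurable (P \<Otimes>\<^sub>M P)"
    using measurable_kant_dist[OF K] P(2) Q(2)
    by (simp_all cong: measurable_cong_sets sets_pair_measure_cong)
  have balls: "mball y \<epsilon> \<in> sets prob_borel" if "y \<in> prob_measures" for y \<epsilon>
    using sets_mball[OF sp(1) sp(1) P.sigma_finite_measure_axioms d(2) that] P(2) by simp
  show ?thesis
    using AE_mball_comparison[OF P(1) Q(1) sp d]
  proof (rule AE_mp[OF _ AE_I2], intro impI)
    fix y assume y: "y \<in> space P"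
      and ev: "\<forall>\<^sub>F \<epsilon> in at_right 0. measure Q (mball y (exp (-2) * \<epsilon>)) \<le> (- ln \<epsilon>) ^ 3 * measure P (mball y \<epsilon>)"
    let ?p = "\<lambda>\<epsilon>. measure P (mball y \<epsilon>)" and ?q = "\<lambda>\<epsilon>. measure Q (mball y \<epsilon>)"
    have "\<forall>\<^sub>F \<epsilon> in at_right (0::real). 1 / t \<le> (- ln \<epsilon>) ^ 3" by real_asymp
    then have ev': "\<forall>\<^sub>F \<epsilon> in at_right 0. ?p (1 * \<epsilon>) \<le> (- ln \<epsilon>) ^ 3 * ?q \<epsilon>"
    proof eventually_elim
      case (elim \<epsilon>)
      have "?p \<epsilon> \<le> 1 / t * ?q \<epsilon>"
        using le[of "mball y \<epsilon>"] balls[of y \<epsilon>] y sp t by (simp add: field_simps)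
      also have "\<dots> \<le> (- ln \<epsilon>) ^ 3 * ?q \<epsilon>" using elim by (intro mult_right_mono) auto
      finally show ?case by simp
    qed
    have "e2ennreal (upper_scl S ?p) = e2ennreal (upper_scl S ?q)"
      by (intro antisym scl_mono(1)[OF _ _ _ _ _ _ ev] scl_mono(1)[OF _ _ _ _ _ _ ev']) auto
    moreover have "e2ennreal (lower_scl S ?p) = e2ennreal (lower_scl S ?q)"
      by (intro antisym scl_mono(2)[OF _ _ _ _ _ _ ev] scl_mono(2)[OF _ _ _ _ _ _ ev']) auto
    ultimately show "e2ennreal (upper_local_scl S prob_measures kant_dist P y)
           = e2ennreal (upper_local_scl S prob_measures kant_dist Q y)
       \<and> e2ennreal (lower_local_scl S prob_measures kant_dist P y)
           = e2ennreal (lower_local_scl S prob_measures kant_dist Q y)"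
      by (simp add: upper_local_scl_def lower_local_scl_def)
  qed
qed

theorem theorem4p4:
  fixes f :: "'a::metric_space \<Rightarrow> 'a"
    and \<mu> \<mu>\<^sub>o \<mu>\<^sub>1 :: "'a measure"
    and t :: real
    and Scl :: scaling
  assumes "compact (UNIV :: 'a set)"
    and "continuous_on UNIV f"
    and "\<mu> \<in> prob_measures"
    and "empirical f \<mu>"
    and "\<mu>\<^sub>o \<in> prob_measures"
    and "\<mu>\<^sub>1 \<in> prob_measures"
    and "0 < t" and "t < 1"
    and "\<forall>A \<in> sets borel.
           emeasure \<mu> A = ennreal t * emeasure \<mu>\<^sub>o A + ennreal (1 - t) * emeasure \<mu>\<^sub>1 A"
  shows "upper_local_emergence Scl f \<mu> =
           ennreal t * upper_local_emergence Scl f \<mu>\<^sub>o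
           + ennreal (1 - t) * upper_local_emergence Scl f \<mu>\<^sub>1 \<and>
         lower_local_emergence Scl f \<mu> =
           ennreal t * lower_local_emergence Scl f \<mu>\<^sub>o
           + ennreal (1 - t) * lower_local_emergence Scl f \<mu>\<^sub>1"
proof -
  note K = assms(1)
  define N where "N \<rho> = empirical_push f \<rho>" for \<rho>
  have meas: "empirical_limit f \<in> measurable \<rho> prob_borel" if "\<rho> \<in> prob_measures" for \<rho>
    using measurable_empirical_limit[OF K assms(2)] that
    by (simp add: prob_measures_def cong: measurable_cong_sets)
  have sets_N: "sets (N \<rho>) = sets prob_borel" for \<rho>
    by (simp add: N_def empirical_push_def)
  have prob_N: "prob_space (N \<rho>)" if "\<rho> \<in> prob_measures" for \<rho>
    using prob_space.prob_space_distr[OF _ meas[OF that]] that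
    by (simp add: N_def empirical_push_def prob_measures_def)
  have mix: "emeasure (N \<mu>) A = ennreal t * emeasure (N \<mu>\<^sub>o) A + ennreal (1 - t) * emeasure (N \<mu>\<^sub>1) A"
    if A: "A \<in> sets prob_borel" for A
  proof -
    have "empirical_limit f -` A \<in> sets borel"
      using measurable_sets[OF measurable_empirical_limit[OF K assms(2)] A] by simp
    moreover have "emeasure (N \<rho>) A = emeasure \<rho> (empirical_limit f -` A)" if "\<rho> \<in> prob_measures" for \<rho>
      using that A emeasure_distr[OF meas[OF that] A] sets_eq_imp_space_eq[of \<rho> borel]
      by (simp add: N_def empirical_push_def prob_measures_def)
    ultimately show ?thesis using assms by simp
  qed
  have mix': "measure (N \<mu>) A = t * measure (N \<mu>\<^sub>o) A + (1 - t) * measure (N \<mu>\<^sub>1) A"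
    if A: "A \<in> sets prob_borel" for A
  proof -
    have "emeasure (N \<rho>) A = ennreal (measure (N \<rho>) A)" if "\<rho> \<in> prob_measures" for \<rho>
      using prob_N[OF that] by (simp add: prob_space.finite_measure finite_measure.emeasure_eq_measure)
    then have "ennreal (measure (N \<mu>) A) = ennreal (t * measure (N \<mu>\<^sub>o) A + (1 - t) * measure (N \<mu>\<^sub>1) A)"
      using mix[OF A] assms by (simp add: ennreal_mult)
    then show ?thesis using assms by (subst (asm) ennreal_inj) auto
  qed
  have lin: "integral\<^sup>N (N \<mu>) F = ennreal t * integral\<^sup>N (N \<mu>\<^sub>o) F + ennreal (1 - t) * integral\<^sup>N (N \<mu>\<^sub>1) F" for F
    using mix by (intro nn_integral_mixture) (simp_all add: sets_N)
  have o: "AE y in N \<mu>\<^sub>o. e2ennreal (upper_local_scl Scl prob_measures kant_dist (N \<mu>\<^sub>o) y)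
           = e2ennreal (upper_local_scl Scl prob_measures kant_dist (N \<mu>) y)
       \<and> e2ennreal (lower_local_scl Scl prob_measures kant_dist (N \<mu>\<^sub>o) y)
           = e2ennreal (lower_local_scl Scl prob_measures kant_dist (N \<mu>) y)"
    using assms mix' by (intro AE_local_scl_eq[OF K _ _ _ _ \<open>0 < t\<close>] prob_N sets_N) auto
  have "0 < 1 - t" using assms by simp
  then have 1: "AE y in N \<mu>\<^sub>1. e2ennreal (upper_local_scl Scl prob_measures kant_dist (N \<mu>\<^sub>1) y)
           = e2ennreal (upper_local_scl Scl prob_measures kant_dist (N \<mu>) y)
       \<and> e2ennreal (lower_local_scl Scl prob_measures kant_dist (N \<mu>\<^sub>1) y)
           = e2ennreal (lower_local_scl Scl prob_measures kant_dist (N \<mu>) y)"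
    using assms mix' by (intro AE_local_scl_eq[OF K, where t = "1 - t"] prob_N sets_N) auto
  \<comment> \<open>Under each of the three laws the local scales of the mixture may be used instead.\<close>
  have "upper_local_emergence Scl f \<rho> = (\<integral>\<^sup>+ \<nu>. e2ennreal (upper_local_scl Scl prob_measures kant_dist (N \<mu>) \<nu>) \<partial>(N \<rho>))"
    "lower_local_emergence Scl f \<rho> = (\<integral>\<^sup>+ \<nu>. e2ennreal (lower_local_scl Scl prob_measures kant_dist (N \<mu>) \<nu>) \<partial>(N \<rho>))"
    if "\<rho> \<in> {\<mu>, \<mu>\<^sub>o, \<mu>\<^sub>1}" for \<rho>
    unfolding upper_local_emergence_def lower_local_emergence_def N_def[symmetric]
    by (intro nn_integral_cong_AE; use that o 1 in auto)+
  then show ?thesis using lin by simp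
qed

end
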